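(* There is no bipartite polyhedral graph with $V=10$ vertices and $E=15$ edges. Equivalently, for $k=5$, the lower endpoint $E=3k=15$ of the interval $3k\le E\le 4k-4$ is not realizable, i.e. there is no bipartite polyhedral graph with both bipartition classes of size $5$ and with $15$ edges. Dually, there is no simple even triangulation of the sphere on seven vertices.
   Context: All graphs are finite and simple. A polyhedral graph is the graph (vertices and edges) of a convex three-dimensional polyhedron; equivalently, by Steinitz's theorem, a planar 3-connected graph. A simple triangulation of the sphere is a simple graph embedded in the sphere such that every face is bounded by a cycle of length three; it is even (or Eulerian) if every vertex has even degree. *)

theory Defs
  imports "HOL-Analysis.Analysis"
begin

definition simple_graph :: "'a set \<Rightarrow> 'a set set \<Rightarrow> bool" where
  "simple_graph V E \<longleftrightarrow> finite V \<and> (\<forall>e\<in>E. e \<subseteq> V \<and> card e = 2)"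

definition bipartition :: "'a set \<Rightarrow> 'a set set \<Rightarrow> 'a set \<Rightarrow> 'a set \<Rightarrow> bool" where
  "bipartition V E A B \<longleftrightarrow>
     A \<union> B = V \<and> A \<inter> B = {} \<and> (\<forall>e\<in>E. \<exists>a\<in>A. \<exists>b\<in>B. e = {a, b})"

definition bipartite :: "'a set \<Rightarrow> 'a set set \<Rightarrow> bool" where
  "bipartite V E \<longleftrightarrow> (\<exists>A B. bipartition V E A B)"

definition graph_isomorphism ::
  "'a set \<Rightarrow> 'a set set \<Rightarrow> 'b set \<Rightarrow> 'b set set \<Rightarrow> ('a \<Rightarrow> 'b) \<Rightarrow> bool" where
  "graph_isomorphism V E W D f \<longleftrightarrow> bij_betw f V W \<and> (\<lambda>e. f ` e) ` E = D"

definition polytope_vertices :: "(real ^ 3) set \<Rightarrow> (real ^ 3) set" where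
  "polytope_vertices P = {x. x extreme_point_of P}"

text \<open>A one-dimensional face of a polytope is a segment; it is recorded by its pair of endpoints.\<close>

definition polytope_edges :: "(real ^ 3) set \<Rightarrow> (real ^ 3) set set" where
  "polytope_edges P = {{x, y} |x y. closed_segment x y edge_of P}"

definition polyhedral_graph :: "'a set \<Rightarrow> 'a set set \<Rightarrow> bool" where
  "polyhedral_graph V E \<longleftrightarrow> simple_graph V E \<and>
     (\<exists>P f. polytope P \<and> aff_dim P = 3 \<and>
        graph_isomorphism V E (polytope_vertices P) (polytope_edges P) f)"

abbreviation unit_sphere :: "(real ^ 3) set" where
  "unit_sphere \<equiv> sphere 0 1"

text \<open>An embedding places the vertices at the points \<open>p v\<close> and draws the edge \<open>e\<close> as the
  simple arc \<open>\<gamma> e\<close>; arcs meet vertices and each other only at common ends.\<close>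

definition sphere_embedding ::
  "'a set \<Rightarrow> 'a set set \<Rightarrow> ('a \<Rightarrow> real ^ 3) \<Rightarrow> ('a set \<Rightarrow> real \<Rightarrow> real ^ 3) \<Rightarrow> bool" where
  "sphere_embedding V E p \<gamma> \<longleftrightarrow>
     inj_on p V \<and> p ` V \<subseteq> unit_sphere \<and>
     (\<forall>e\<in>E. arc (\<gamma> e) \<and> path_image (\<gamma> e) \<subseteq> unit_sphere \<and>
        {pathstart (\<gamma> e), pathfinish (\<gamma> e)} = p ` e \<and>
        path_image (\<gamma> e) \<inter> p ` V = p ` e) \<and>
     (\<forall>e\<in>E. \<forall>e'\<in>E. e \<noteq> e' \<longrightarrow> path_image (\<gamma> e) \<inter> path_image (\<gamma> e') = p ` (e \<inter> e'))"

definition embedding_faces ::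
  "'a set \<Rightarrow> 'a set set \<Rightarrow> ('a \<Rightarrow> real ^ 3) \<Rightarrow> ('a set \<Rightarrow> real \<Rightarrow> real ^ 3) \<Rightarrow> (real ^ 3) set set" where
  "embedding_faces V E p \<gamma> =
     components (unit_sphere - (p ` V \<union> (\<Union>e\<in>E. path_image (\<gamma> e))))"

definition simple_sphere_triangulation ::
  "'a set \<Rightarrow> 'a set set \<Rightarrow> ('a \<Rightarrow> real ^ 3) \<Rightarrow> ('a set \<Rightarrow> real \<Rightarrow> real ^ 3) \<Rightarrow> bool" where
  "simple_sphere_triangulation V E p \<gamma> \<longleftrightarrow>
     simple_graph V E \<and> sphere_embedding V E p \<gamma> \<and>
     (\<forall>F\<in>embedding_faces V E p \<gamma>. \<exists>a b c.
        a \<noteq> b \<and> b \<noteq> c \<and> a \<noteq> c \<and> {{a, b}, {b, c}, {a, c}} \<subseteq> E \<and>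
        top_of_set unit_sphere frontier_of F =
          path_image (\<gamma> {a, b}) \<union> path_image (\<gamma> {b, c}) \<union> path_image (\<gamma> {a, c}))"

definition all_degrees_even :: "'a set \<Rightarrow> 'a set set \<Rightarrow> bool" where
  "all_degrees_even V E \<longleftrightarrow> (\<forall>v\<in>V. even (card {e\<in>E. v \<in> e}))"

end

theory Submission
  imports Defs
begin

text \<open>
  A polytope with 10 vertices and 15 edges is simple, so a generic linear functional yields Euler's
  formula and hence seven facets. If the graph is bipartite, these are one hexagon and six
  quadrilaterals, all adjacent to the hexagon, and counting the edges that leave the hexagon gives a
  contradiction.

  In a triangulation of the sphere every face is one side of a triangle of the graph, by the Jordan
  curve theorem. Hence every edge lies on exactly two face triangles, and a triangle of the graph that
  bounds no face has vertices on both sides. For seven vertices of degrees 4 and 6 the face count allows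
  only one, four or seven vertices of degree 6. A triangle through two of them that bounds no face excludes
  the last two cases, and the links of the vertices of degree 4 exclude the first.
\<close>

section \<open>Simple three-dimensional polytopes\<close>

text \<open>At a vertex of degree three every facet contains exactly two of the three edges, so the
  facets at the vertex correspond to the omitted edges, and whether the vertex is the top of a facet
  or of the whole polytope can be read off from its descending edges. This turns Euler's formula
  into a sum of local terms over the vertices. Each vertex lies on three facets, so the facet sizes
  sum to 30, and seven even numbers of size at least 4 with this sum can only be 6 and six times 4.
  On the sphere the definition supplies a face only with its frontier, and the obstacle is to
  recognise the face from it: a connected open set whose frontier is a Jordan curve is clopen in one
  side of the curve, hence equal to that side. That no edge lies on three face triangles becomes a
  statement about four arcs with common ends. The face count there is a divisibility argument: three
  times the number of faces is the degree sum \<open>28 + 2 * card U\<close>, where \<open>U\<close>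
  is the set of vertices of degree 6.\<close>

lemma span_translate_orthogonal:
  fixes a :: "'a::euclidean_space"
  assumes "\<And>x. x \<in> C \<Longrightarrow> a \<bullet> x = b" "z \<in> C" "l \<in> span ((\<lambda>x. x - z) ` C)"
  shows "a \<bullet> l = 0"
  using assms(3)
proof (induction rule: span_induct)
  case base
  show ?case
    by (auto simp: subspace_def inner_right_distrib)
next
  case (step x)
  then show ?case using assms(1,2) by (auto simp: inner_diff_right)
qed

text \<open>Proper inclusions of faces lower the dimension. If \<open>C\<close>,
  \<open>F \<inter> G\<close> and \<open>F\<close> were three different faces, then \<open>C\<close>
  would have codimension at least three in \<open>S\<close>.\<close>

lemma ridge_eq_Int_facets:
  fixes S :: "'a::euclidean_space set"
  assumes "C face_of S" "aff_dim C = aff_dim S - 2"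
    and "F facet_of S" "C \<subseteq> F" "G facet_of S" "C \<subseteq> G" "F \<noteq> G"
  shows "C = F \<inter> G"
proof (rule ccontr)
  assume ne: "C \<noteq> F \<inter> G"
  have fF: "F face_of S" and fG: "G face_of S"
    using assms facet_of_imp_face_of by auto
  have "C face_of F \<inter> G"
    using assms(1,4,6) fF fG by (meson face_of_Int face_of_imp_subset face_of_subset le_inf_iff)
  then have 1: "aff_dim C < aff_dim (F \<inter> G)"
    using ne face_of_aff_dim_lt[of "F \<inter> G" C] fF fG face_of_Int face_of_imp_convex by blast
  have "F \<inter> G \<noteq> F"
  proof
    assume "F \<inter> G = F"
    then have "F face_of G" using fF fG
      by (meson face_of_imp_subset face_of_subset inf.absorb_iff1)
    then have "aff_dim F < aff_dim G"
      using assms(7) face_of_aff_dim_lt fG face_of_imp_convex by blast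
    then show False using assms(3,5) by (simp add: facet_of_def)
  qed
  moreover have "F \<inter> G face_of F" 
    using fF fG by (meson face_of_Int face_of_imp_subset face_of_subset inf_le1)
  ultimately have "aff_dim (F \<inter> G) < aff_dim F"
    using face_of_aff_dim_lt fF face_of_imp_convex by blast
  then show False using 1 assms(2,3) by (simp add: facet_of_def)
qed

text \<open>Modulo the affine hull of the ridge \<open>C\<close> the polyhedron is a pointed cone in a plane; a third
  facet through \<open>C\<close> would be a boundary ray positively spanned by the two others.\<close>

proposition polyhedron_ridge_two_facets:
  fixes S :: "'a::euclidean_space set"
  assumes S: "polyhedron S" and C: "C face_of S" "C \<noteq> {}" "aff_dim C = aff_dim S - 2"
  shows "card {F. F facet_of S \<and> C \<subseteq> F} = 2"
proof -
  define \<F> where "\<F> = {F. F facet_of S \<and> C \<subseteq> F}"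
  have CI: "C = \<Inter>\<F>"
    using face_of_polyhedron[OF S C(1,2)] C(3) unfolding \<F>_def by force
  have fin: "finite \<F>"
    unfolding \<F>_def by (rule finite_subset[OF _ finite_polyhedron_facets[OF S]]) auto
  have "\<F> \<noteq> {}"
  proof
    assume "\<F> = {}"
    then have "C = UNIV" using CI by simp
    moreover have "C \<subseteq> S" using C(1) face_of_imp_subset by blast
    ultimately have "C = S" by auto
    then show False using C(3) by simp
  qed
  then obtain F1 where F1: "F1 \<in> \<F>" by auto
  have "\<F> \<noteq> {F1}"
  proof
    assume "\<F> = {F1}"
    then have "C = F1" using CI by simp
    then show False using F1 C(3) by (simp add: \<F>_def facet_of_def)
  qed
  then obtain F2 where F2: "F2 \<in> \<F>" "F2 \<noteq> F1" using F1 by auto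
  have "F3 = F1 \<or> F3 = F2" if F3: "F3 \<in> \<F>" for F3
  proof (rule ccontr)
    assume "\<not> (F3 = F1 \<or> F3 = F2)"
    then have ne: "F3 \<noteq> F1" "F3 \<noteq> F2" by auto
    have facet: "F1 facet_of S" "F2 facet_of S" "F3 facet_of S" "C \<subseteq> F1" "C \<subseteq> F2" "C \<subseteq> F3"
      using F1 F2 F3 by (auto simp: \<F>_def)
    have int: "F1 \<inter> F2 = C" "F1 \<inter> F3 = C" "F2 \<inter> F3 = C"
      using ridge_eq_Int_facets[OF C(1,3)] facet ne F2(2) by metis+
    have neC: "F \<noteq> C" if "F facet_of S" for F
      using that C(3) by (auto simp: facet_of_def)
    obtain y1 where y1: "y1 \<in> F1" "y1 \<notin> C" using neC facet by blast
    obtain y2 where y2: "y2 \<in> F2" "y2 \<notin> C" using neC facet by blast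
    obtain y3 where y3: "y3 \<in> F3" "y3 \<notin> C" using neC facet by blast
    have yS: "y1 \<in> S" "y2 \<in> S" "y3 \<in> S"
      using y1 y2 y3 facet facet_of_imp_subset by blast+
    obtain a1 b1 where a1: "S \<subseteq> {x. a1 \<bullet> x \<le> b1}" "F1 = S \<inter> {x. a1 \<bullet> x = b1}"
      using facet_of_polyhedron[OF S facet(1)] by metis
    obtain a2 b2 where a2: "S \<subseteq> {x. a2 \<bullet> x \<le> b2}" "F2 = S \<inter> {x. a2 \<bullet> x = b2}"
      using facet_of_polyhedron[OF S facet(2)] by metis
    obtain a3 b3 where a3: "S \<subseteq> {x. a3 \<bullet> x \<le> b3}" "F3 = S \<inter> {x. a3 \<bullet> x = b3}"
      using facet_of_polyhedron[OF S facet(3)] by metis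
    obtain z where z: "z \<in> C" using C(2) by auto
    have CS: "C \<subseteq> S" using C(1) face_of_imp_subset by blast
    have hullC: "affine hull C \<inter> S = C"
      using C(1) S by (metis affine_hull_face_of_disjoint_rel_interior face_of_imp_eq_affine_Int 
          polyhedron_imp_convex inf_commute)
    have y1C: "y1 \<notin> affine hull C" using hullC y1 yS by auto
    \<comment> \<open>\<open>F1\<close> lies in the hyperplane of \<open>a1\<close>, and so does the
      affine hull of \<open>y1\<close> and \<open>C\<close>. Hence \<open>y2\<close> adds a
      dimension, and \<open>C\<close>, \<open>y1\<close>, \<open>y2\<close> together span the affine
      hull of \<open>S\<close>, which gives \<open>y3\<close> two coordinates modulo the directions
      of \<open>C\<close>.\<close>
    have y2C: "y2 \<notin> affine hull (insert y1 C)"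
    proof
      assume "y2 \<in> affine hull (insert y1 C)"
      also have "\<dots> \<subseteq> affine hull {x. a1 \<bullet> x = b1}"
        using a1(2) facet(4) y1(1) by (intro hull_mono) auto
      also have "\<dots> = {x. a1 \<bullet> x = b1}" by (simp add: affine_hyperplane hull_same)
      finally have "y2 \<in> F1" using a1(2) yS by auto
      then show False using int y2 by auto
    qed
    have dim: "aff_dim (insert y2 (insert y1 C)) = aff_dim S"
      using y1C y2C C(3) by (simp add: aff_dim_insert)
    have "affine hull (insert y2 (insert y1 C)) = affine hull S"
    proof (rule affine_dim_equal)
      show "affine hull (insert y2 (insert y1 C)) \<subseteq> affine hull S"
        using yS CS by (intro hull_mono) auto
    qed (use dim in auto)
    then have "y3 \<in> affine hull (insert y2 (insert y1 C))"
      using yS(3) by (simp add: hull_inc)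
    \<comment> \<open>Inserting the point \<open>z\<close> of \<open>C\<close> once more makes it
      the base point from which all directions are measured.\<close>
    also have "insert y2 (insert y1 C) = insert z (insert y2 (insert y1 C))" using z by auto
    finally have "y3 - z \<in> span ((\<lambda>x. x - z) ` (insert y2 (insert y1 C)))"
      by (auto simp: affine_hull_insert_span_gen)
    then obtain k1 k2 where l: "y3 - z - k2 *\<^sub>R (y2 - z) - k1 *\<^sub>R (y1 - z) \<in> span ((\<lambda>x. x - z) ` C)"
      by (auto simp: span_insert)
    define l where "l = y3 - z - k2 *\<^sub>R (y2 - z) - k1 *\<^sub>R (y1 - z)"
    have eq: "y3 - z = k1 *\<^sub>R (y1 - z) + k2 *\<^sub>R (y2 - z) + l" by (simp add: l_def)
    have C1: "a1 \<bullet> x = b1" and C2: "a2 \<bullet> x = b2" and C3: "a3 \<bullet> x = b3" if "x \<in> C" for x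
      using that facet(4-6) a1(2) a2(2) a3(2) by auto
    have "a1 \<bullet> l = 0" 
      using span_translate_orthogonal[OF C1 z] l by (simp add: l_def)
    moreover have "a2 \<bullet> l = 0" 
      using span_translate_orthogonal[OF C2 z] l by (simp add: l_def)
    moreover have "a3 \<bullet> l = 0" 
      using span_translate_orthogonal[OF C3 z] l by (simp add: l_def)
    ultimately have e: "a1 \<bullet> (y3 - z) = k1 * (a1 \<bullet> (y1 - z)) + k2 * (a1 \<bullet> (y2 - z))"
      "a2 \<bullet> (y3 - z) = k1 * (a2 \<bullet> (y1 - z)) + k2 * (a2 \<bullet> (y2 - z))"
      "a3 \<bullet> (y3 - z) = k1 * (a3 \<bullet> (y1 - z)) + k2 * (a3 \<bullet> (y2 - z))"
      by (simp_all add: eq inner_add_right)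
    have zF: "z \<in> F1" "z \<in> F2" "z \<in> F3" using z facet by auto
    have zero: "a1 \<bullet> (y1 - z) = 0" "a2 \<bullet> (y2 - z) = 0" "a3 \<bullet> (y3 - z) = 0"
      using a1(2) a2(2) a3(2) y1 y2 y3 zF by (auto simp: inner_diff_right)
    have neg: "a \<bullet> (y - z) < 0" if "S \<subseteq> {x. a \<bullet> x \<le> b}" "F = S \<inter> {x. a \<bullet> x = b}" "z \<in> F" "y \<in> S" "y \<notin> F" for a b F y
      using that by (force simp: inner_diff_right)
    have nF: "y2 \<notin> F1" "y3 \<notin> F1" "y1 \<notin> F2" "y3 \<notin> F2" "y1 \<notin> F3" "y2 \<notin> F3"
      using int y1 y2 y3 by auto
    \<comment> \<open>\<open>a1\<close> vanishes on \<open>y1 - z\<close> and \<open>l\<close> and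
      is negative on \<open>y2 - z\<close> and \<open>y3 - z\<close>, which fixes the sign of
      \<open>k2\<close>; \<open>a2\<close> fixes that of \<open>k1\<close>. Then \<open>a3\<close>,
      negative on \<open>y1 - z\<close> and \<open>y2 - z\<close>, would be negative on
      \<open>y3 - z\<close>, where it vanishes.\<close>
    have "k2 > 0" 
      using e(1) zero neg[OF a1 zF(1) yS(2) nF(1)] neg[OF a1 zF(1) yS(3) nF(2)] 
      by (auto simp: mult_less_0_iff)
    moreover have "k1 > 0" 
      using e(2) zero neg[OF a2 zF(2) yS(1) nF(3)] neg[OF a2 zF(2) yS(3) nF(4)] 
      by (auto simp: mult_less_0_iff)
    ultimately have "k1 * (a3 \<bullet> (y1 - z)) + k2 * (a3 \<bullet> (y2 - z)) < 0"
      using neg[OF a3 zF(3) yS(1) nF(5)] neg[OF a3 zF(3) yS(2) nF(6)]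
      by (intro add_neg_neg) (auto simp: mult_less_0_iff)
    then show False using e(3) zero by simp
  qed
  then have "\<F> = {F1, F2}" using F1 F2 by auto
  then show ?thesis using F2 unfolding \<F>_def by simp
qed

section \<open>Incidences of vertices, edges and facets of a three-dimensional polytope\<close>

locale polytope3 =
  fixes P :: "(real^3) set"
  assumes polytope: "polytope P" and aff_dim3: "aff_dim P = 3"
begin

definition verts where "verts = {x. x extreme_point_of P}"
text \<open>Edges are kept as point sets, so that the theory of faces applies; the pair of ends is
  recovered as \<open>e \<inter> verts\<close>.\<close>

definition segs where "segs = {e. e edge_of P}"
definition facets where "facets = {F. F facet_of P}"
definition star where "star v = {e \<in> segs. v \<in> e}"

lemma polyhedron: "polyhedron P"
  by (simp add: polytope polytope_imp_polyhedron)

lemma finite_verts [simp]: "finite verts"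
  unfolding verts_def by (rule finite_polyhedron_extreme_points[OF polyhedron])

lemma finite_segs [simp]: "finite segs"
  by (rule finite_subset[OF _ finite_polytope_faces[OF polytope]]) (auto simp: segs_def edge_of_def)

lemma finite_facets [simp]: "finite facets"
  unfolding facets_def by (rule finite_polytope_facets[OF polytope])

lemma finite_star [simp]: "finite (star v)"
  by (simp add: star_def)

lemma segment_ends:
  assumes "e \<in> segs"
  obtains x y where "x \<noteq> y" "e = closed_segment x y" "e \<inter> verts = {x, y}"
proof -
  have e: "e face_of P" "aff_dim e = 1" using assms by (auto simp: segs_def edge_of_def)
  have pe: "polytope e" using e polytope face_of_polytope_polytope by blast
  have "collinear e" using e(2) by (simp add: collinear_aff_dim)
  moreover have "e \<noteq> {}" using e(2) by auto
  ultimately obtain x y where xy: "e = closed_segment x y"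
    using compact_convex_collinear_segment pe polytope_imp_compact polytope_imp_convex by metis
  have "x \<noteq> y" using xy e(2) by auto
  moreover have "e \<inter> verts = {x, y}"
    using extreme_point_of_face[OF e(1)] extreme_point_of_segment[of _ x y] xy unfolding verts_def by auto
  ultimately show thesis using xy that by blast
qed

lemma card_seg_verts: "e \<in> segs \<Longrightarrow> card {v \<in> verts. v \<in> e} = 2"
proof -
  assume "e \<in> segs"
  then obtain x y where xy: "x \<noteq> y" "e \<inter> verts = {x, y}" by (meson segment_ends)
  moreover have "{v \<in> verts. v \<in> e} = e \<inter> verts" by auto
  ultimately show ?thesis by simp
qed

lemma seg_eqI:
  assumes "e \<in> segs" "e' \<in> segs" "x \<noteq> y" "x \<in> verts" "y \<in> verts" "x \<in> e" "y \<in> e" "x \<in> e'" "y \<in> e'"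
  shows "e = e'"
proof -
  have "e = closed_segment x y" if e: "e \<in> segs" and "x \<in> e" "y \<in> e" for e
  proof -
    obtain s t where st: "e = closed_segment s t" "e \<inter> verts = {s, t}" using segment_ends[OF e] by metis
    have "x \<in> e \<inter> verts" "y \<in> e \<inter> verts" using that assms by auto
    then have "{x, y} = {s, t}" using st(2) assms(3) by auto
    then show ?thesis using st(1) by (metis closed_segment_commute doubleton_eq_iff)
  qed
  then show ?thesis using assms by metis
qed

lemma card_facets_seg: "e \<in> segs \<Longrightarrow> card {F \<in> facets. e \<subseteq> F} = 2"
  using polyhedron_ridge_two_facets[OF polyhedron, of e] aff_dim3
  by (cases "e = {}") (auto simp: segs_def facets_def edge_of_def)

text \<open>The ridge theorem again, now inside the polygon \<open>F\<close>: a vertex is a face of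
  codimension two there.\<close>

lemma card_segs_facet:
  assumes F: "F \<in> facets" and v: "v \<in> verts" "v \<in> F"
  shows "card {e \<in> star v. e \<subseteq> F} = 2"
proof -
  have f: "F face_of P" "aff_dim F = 2" 
    using F aff_dim3 by (auto simp: facets_def facet_of_def)
  have "{v} face_of F" 
    using v f(1) extreme_point_of_face[OF f(1)] by (auto simp: verts_def face_of_singleton)
  then have "card {e. e facet_of F \<and> {v} \<subseteq> e} = 2"
    using f polyhedron by (intro polyhedron_ridge_two_facets) (auto intro: face_of_polyhedron_polyhedron)
  moreover have "{e. e facet_of F \<and> {v} \<subseteq> e} = {e \<in> star v. e \<subseteq> F}"
    using f by (auto simp: star_def segs_def facet_of_def edge_of_def face_of_face[OF f(1)])
  ultimately show ?thesis by simp
qed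

lemma seg_subset_facet:
  assumes F: "F \<in> facets" and e: "e \<in> segs" and "x \<noteq> y" "x \<in> verts" "y \<in> verts" "x \<in> e" "y \<in> e" "x \<in> F" "y \<in> F"
  shows "e \<subseteq> F"
proof -
  obtain s t where st: "e = closed_segment s t" "e \<inter> verts = {s, t}" using segment_ends[OF e] by metis
  have "x \<in> e \<inter> verts" "y \<in> e \<inter> verts" using assms by auto
  then have "{x, y} = {s, t}" using st(2) assms(3) by auto
  moreover have "convex F" 
    using F face_of_imp_convex by (auto simp: facets_def facet_of_def)
  then have "closed_segment x y \<subseteq> F" using assms by (intro closed_segment_subset)
  ultimately show ?thesis using st(1) by (auto simp: doubleton_eq_iff closed_segment_commute)
qed

lemma facets_share_seg:
  assumes "F \<in> facets" "G \<in> facets" "F \<noteq> G" "e \<in> segs" "e' \<in> segs" "e \<subseteq> F" "e \<subseteq> G" "e' \<subseteq> F" "e' \<subseteq> G"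
  shows "e = e'"
proof -
  have "e = F \<inter> G" if "e \<in> segs" "e \<subseteq> F" "e \<subseteq> G" for e
    using that assms(1,2,3) aff_dim3
    by (intro ridge_eq_Int_facets[of e P]) (auto simp: segs_def facets_def edge_of_def)
  then show ?thesis using assms by metis
qed

lemma vertex_in_facet: "v \<in> verts \<Longrightarrow> \<exists>F \<in> facets. v \<in> F"
  using face_of_polyhedron_subset_facet[OF polyhedron, of "{v}"] aff_dim3
  by (force simp: verts_def facets_def face_of_singleton)

lemma facet_has_vertex: 
  assumes F: "F \<in> facets" shows "\<exists>v \<in> verts. v \<in> F"
proof -
  have f: "F face_of P" "F \<noteq> {}" 
    using F by (auto simp: facets_def facet_of_def)
  then have "polytope F" using polytope face_of_polytope_polytope by blast
  then obtain v where "v extreme_point_of F"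
    using f(2) extreme_point_exists_convex polytope_imp_compact polytope_imp_convex by blast
  then show ?thesis using extreme_point_of_face[OF f(1)] by (auto simp: verts_def)
qed

text \<open>Double counting of the pairs of an edge at \<open>v\<close> and a facet containing it:
  two facets per edge, two edges per facet.\<close>

lemma card_facets_vertex:
  assumes v: "v \<in> verts"
  shows "card {F \<in> facets. v \<in> F} = card (star v)"
proof -
  have "card {F \<in> {F \<in> facets. v \<in> F}. e \<subseteq> F} = 2" if "e \<in> star v" for e
  proof -
    have "{F \<in> {F \<in> facets. v \<in> F}. e \<subseteq> F} = {F \<in> facets. e \<subseteq> F}"
      using that by (auto simp: star_def)
    then show ?thesis using that card_facets_seg by (simp add: star_def)
  qed
  then have "(\<Sum>F \<in> {F \<in> facets. v \<in> F}. card {e \<in> star v. e \<subseteq> F}) = (\<Sum>e\<in>star v. 2)"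
    by (intro sum_multicount_gen) auto
  moreover have "(\<Sum>F \<in> {F \<in> facets. v \<in> F}. card {e \<in> star v. e \<subseteq> F}) = (\<Sum>F \<in> {F \<in> facets. v \<in> F}. 2)"
    using card_segs_facet v by (intro sum.cong) auto
  ultimately show ?thesis by simp
qed

text \<open>With only two edges at \<open>v\<close>, every facet at \<open>v\<close> would contain
  both, but two different facets share at most one edge.\<close>

lemma card_star_ge3:
  assumes v: "v \<in> verts"
  shows "card (star v) \<ge> 3"
proof -
  obtain F where F: "F \<in> facets" "v \<in> F" using vertex_in_facet v by auto
  have "card {e \<in> star v. e \<subseteq> F} \<le> card (star v)" by (intro card_mono) auto
  then have 2: "card (star v) \<ge> 2" using card_segs_facet[OF F(1) v F(2)] by simp
  have False if c2: "card (star v) = 2"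
  proof -
    have all: "{e \<in> star v. e \<subseteq> F} = star v" if "F \<in> facets" "v \<in> F" for F
      using card_segs_facet[OF that(1) v that(2)] c2 by (intro card_subset_eq) auto
    obtain e e' where e: "star v = {e, e'}" "e \<noteq> e'" using c2 by (auto simp: card_2_iff)
    have "card {F \<in> facets. v \<in> F} = 2" using card_facets_vertex v c2 by simp
    then obtain F G where FG: "{F \<in> facets. v \<in> F} = {F, G}" "F \<noteq> G" by (auto simp: card_2_iff)
    then have "F \<in> facets" "G \<in> facets" "v \<in> F" "v \<in> G" by auto
    then have FG': "F \<in> facets" "G \<in> facets" "star v \<subseteq> {e. e \<subseteq> F}" "star v \<subseteq> {e. e \<subseteq> G}" 
      using all by blast+
    moreover have "e \<in> star v" "e' \<in> star v" using e by auto
    ultimately show False using facets_share_seg[OF FG'(1,2) FG(2), of e e'] e(2) 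
      unfolding star_def by blast
  qed
  then show ?thesis using 2 by (cases "card (star v) = 2") auto
qed

text \<open>Meaningful at vertices of degree three, where a facet through \<open>v\<close> misses
  exactly one of the three edges.\<close>

definition omitted :: "real^3 \<Rightarrow> (real^3) set \<Rightarrow> (real^3) set" where
  "omitted v F = (THE e. e \<in> star v \<and> \<not> e \<subseteq> F)"

lemma omitted_props:
  assumes v: "v \<in> verts" and c3: "card (star v) = 3" and F: "F \<in> facets" "v \<in> F"
  shows "omitted v F \<in> star v" "{e \<in> star v. e \<subseteq> F} = star v - {omitted v F}"
proof -
  have "card (star v - {e \<in> star v. e \<subseteq> F}) = 1"
    using card_segs_facet[OF F(1) v F(2)] c3 by (subst card_Diff_subset) auto
  then obtain e where e: "star v - {e \<in> star v. e \<subseteq> F} = {e}" by (auto simp: card_1_singleton_iff)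
  then have "omitted v F = e" unfolding omitted_def by (intro the_equality) auto
  then show "omitted v F \<in> star v" "{e \<in> star v. e \<subseteq> F} = star v - {omitted v F}" using e by auto
qed

text \<open>Two facets omitting the same edge would share the two others, so the map is injective;
  it is onto because there are as many facets at \<open>v\<close> as edges.\<close>

lemma bij_betw_omitted:
  assumes v: "v \<in> verts" and c3: "card (star v) = 3"
  shows "bij_betw (omitted v) {F \<in> facets. v \<in> F} (star v)"
proof -
  note m = omitted_props[OF v c3]
  have inj: "inj_on (omitted v) {F \<in> facets. v \<in> F}"
  proof (rule inj_onI, rule ccontr)
    fix F G assume "F \<in> {F \<in> facets. v \<in> F}" and "G \<in> {F \<in> facets. v \<in> F}" 
      and eq: "omitted v F = omitted v G" and ne: "F \<noteq> G"
    then have F: "F \<in> facets" "v \<in> F" and G: "G \<in> facets" "v \<in> G" by auto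
    have "card (star v - {omitted v F}) = 2" using m(1)[OF F] c3 by simp
    then obtain e e' where e: "star v - {omitted v F} = {e, e'}" "e \<noteq> e'" by (auto simp: card_2_iff)
    have "{e \<in> star v. e \<subseteq> F} = {e, e'}" "{e \<in> star v. e \<subseteq> G} = {e, e'}" 
      unfolding m(2)[OF F] m(2)[OF G] eq[symmetric] e(1) by (rule refl)+
    then have "e \<in> {e \<in> star v. e \<subseteq> F}" "e' \<in> {e \<in> star v. e \<subseteq> F}" 
      "e \<in> {e \<in> star v. e \<subseteq> G}" "e' \<in> {e \<in> star v. e \<subseteq> G}" by blast+
    then show False using facets_share_seg[OF F(1) G(1) ne, of e e'] e(2) 
      unfolding star_def by blast
  qed
  have "omitted v ` {F \<in> facets. v \<in> F} = star v"
    using m card_facets_vertex[OF v] inj by (intro card_subset_eq) (auto simp: card_image)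
  then show ?thesis using inj by (simp add: bij_betw_def)
qed

text \<open>Near a simple vertex the polytope is a simplicial cone, and the coefficient of an edge in cone
  coordinates vanishes on the facet that omits it.\<close>

lemma simple_vertex_local_max:
  assumes v: "v \<in> verts" and c3: "card (star v) = 3" and x: "x \<in> P"
    and mx: "\<And>e u. e \<in> star v \<Longrightarrow> u \<in> e \<inter> verts \<Longrightarrow>
      c \<bullet> u \<le> c \<bullet> v \<or> (\<exists>F\<in>facets. v \<in> F \<and> x \<in> F \<and> e = omitted v F)"
  shows "c \<bullet> x \<le> c \<bullet> v"
proof -
  \<comment> \<open>The direction from \<open>v\<close> to the other end of the edge
    \<open>e\<close>.\<close>
  define d where "d = (\<lambda>e. (THE u. u \<in> e \<inter> verts - {v}) - v)"
  have other: "v + d e \<in> e \<inter> verts - {v}" if "e \<in> star v" for e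
  proof -
    have e: "e \<in> segs" "v \<in> e" using that by (auto simp: star_def)
    obtain s t where st: "s \<noteq> t" "e \<inter> verts = {s, t}" using segment_ends[OF e(1)] by metis
    have "v \<in> {s, t}" using e st v by blast
    then have "\<exists>!u. u \<in> e \<inter> verts - {v}" using st by auto
    from theI'[OF this] show ?thesis by (simp add: d_def)
  qed
  have "\<exists>a b. P \<subseteq> {y. a \<bullet> y \<le> b} \<and> F = P \<inter> {y. a \<bullet> y = b}" if "F \<in> facets" for F
    using facet_of_polyhedron[OF polyhedron] that unfolding facets_def by blast
  then obtain a b where ab: "\<And>F. F \<in> facets \<Longrightarrow> P \<subseteq> {y. a F \<bullet> y \<le> b F} \<and> F = P \<inter> {y. a F \<bullet> y = b F}"
    by metis
  \<comment> \<open>\<open>G e\<close> is the facet at \<open>v\<close> opposite to the edge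
    \<open>e\<close>. Its normal is orthogonal to the other two directions and negative on
    \<open>d e\<close>, so up to scaling the three normals form the dual basis of the edge
    directions.\<close>
  define G where "G = inv_into {F \<in> facets. v \<in> F} (omitted v)"
  have G: "G e \<in> facets" "v \<in> G e" "omitted v (G e) = e" if "e \<in> star v" for e
    using that bij_betw_omitted[OF v c3] unfolding G_def 
    by (auto simp: bij_betw_def f_inv_into_f dest!: inv_into_into)
  have GF: "G (omitted v F) = F" if "F \<in> facets" "v \<in> F" for F
    using that bij_betw_omitted[OF v c3] unfolding G_def bij_betw_def by (auto intro!: inv_into_f_f)
  have sub: "e' \<subseteq> G e \<longleftrightarrow> e' \<noteq> e" if "e \<in> star v" "e' \<in> star v" for e e'
    using omitted_props(2)[OF v c3 G(1,2)[OF that(1)]] G(3)[OF that(1)] that by auto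
  have inG: "v + d e' \<in> G e \<longleftrightarrow> e' \<noteq> e" if "e \<in> star v" "e' \<in> star v" for e e'
  proof
    assume "v + d e' \<in> G e"
    then have "e' \<subseteq> G e" 
      using seg_subset_facet[OF G(1)[OF that(1)], of e' v "v + d e'"] other[OF that(2)] that v G(2)[OF that(1)]
      by (auto simp: star_def)
    then show "e' \<noteq> e" using sub that by auto
  next
    assume "e' \<noteq> e"
    then show "v + d e' \<in> G e" using sub[OF that] other[OF that(2)] by auto
  qed
  have vP: "v \<in> P" using v by (auto simp: verts_def extreme_point_of_def)
  have dP: "v + d e \<in> P" if "e \<in> star v" for e
    using other[OF that] by (auto simp: verts_def extreme_point_of_def)
  have av: "a (G e) \<bullet> v = b (G e)" if "e \<in> star v" for e
    using ab[OF G(1)[OF that]] G(2)[OF that] by auto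
  have ad0: "a (G e) \<bullet> d e' = 0" if "e \<in> star v" "e' \<in> star v" "e \<noteq> e'" for e e'
  proof -
    have "v + d e' \<in> {y. a (G e) \<bullet> y = b (G e)}" using ab[OF G(1)[OF that(1)]] inG[OF that(1,2)] that(3) by blast
    then show ?thesis using av[OF that(1)] by (simp add: inner_add_right)
  qed
  have adneg: "a (G e) \<bullet> d e < 0" if "e \<in> star v" for e
  proof -
    have "a (G e) \<bullet> (v + d e) \<le> b (G e)" using ab[OF G(1)[OF that]] dP[OF that] by auto
    moreover have "a (G e) \<bullet> (v + d e) \<noteq> b (G e)" 
      using ab[OF G(1)[OF that]] dP[OF that] inG[OF that that] by auto
    ultimately show ?thesis using av[OF that] by (simp add: inner_add_right)
  qed
  have expand: "a (G e) \<bullet> (\<Sum>e'\<in>star v. k e' *\<^sub>R d e') = k e * (a (G e) \<bullet> d e)" if "e \<in> star v" for k e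
  proof -
    have "a (G e) \<bullet> (\<Sum>e'\<in>star v. k e' *\<^sub>R d e') = (\<Sum>e'\<in>star v. if e' = e then k e * (a (G e) \<bullet> d e) else 0)"
      unfolding inner_sum_right using ad0[OF that] by (intro sum.cong) auto
    then show ?thesis using that by simp
  qed
  have inj: "inj_on d (star v)"
    using ad0 adneg by (metis inj_onI less_irrefl)
  have ind: "independent (d ` star v)"
  proof (rule independent_if_scalars_zero)
    fix f y assume "(\<Sum>y\<in>d ` star v. f y *\<^sub>R y) = 0" "y \<in> d ` star v"
    moreover from this obtain e where e: "e \<in> star v" "y = d e" by blast
    ultimately have "(\<Sum>e\<in>star v. f (d e) *\<^sub>R d e) = 0" 
      using inj by (simp add: sum.reindex)
    then show "f y = 0" using expand[OF e(1), of "\<lambda>e. f (d e)"] adneg[OF e(1)] e(2) by auto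
  qed auto
  have "card (d ` star v) = DIM(real^3)" using inj c3 by (simp add: card_image)
  then have "span (d ` star v) = UNIV"
    using ind by (metis card_eq_dim dim_eq_full dim_span_eq_card_independent dim_span)
  then have "x - v \<in> span (d ` star v)" by simp
  then obtain f where "x - v = (\<Sum>y\<in>d ` star v. f y *\<^sub>R y)" by (auto simp: span_finite)
  then have eq: "x - v = (\<Sum>e\<in>star v. f (d e) *\<^sub>R d e)" using inj by (simp add: sum.reindex)
  have val: "a (G e) \<bullet> x - b (G e) = f (d e) * (a (G e) \<bullet> d e)" if "e \<in> star v" for e
    using expand[OF that, of "\<lambda>e. f (d e)"] av[OF that] unfolding eq[symmetric] by (simp add: inner_diff_right)
  \<comment> \<open>The coefficient of \<open>d e\<close> is nonnegative because \<open>x\<close>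
    satisfies the inequality of \<open>G e\<close>. Either \<open>c\<close> does not increase along
    \<open>d e\<close>, or \<open>x\<close> lies on the facet omitting \<open>e\<close> and the
    coefficient is zero.\<close>
  have "f (d e) * (c \<bullet> d e) \<le> 0" if e: "e \<in> star v" for e
  proof -
    have "a (G e) \<bullet> x \<le> b (G e)" using ab[OF G(1)[OF e]] x by auto
    then have ge: "0 \<le> f (d e)" using val[OF e] adneg[OF e]
      by (metis diff_le_0_iff_le linorder_not_less mult_neg_neg)
    from mx[OF e, of "v + d e"] other[OF e]
    consider "c \<bullet> (v + d e) \<le> c \<bullet> v" | F where "F \<in> facets" "v \<in> F" "x \<in> F" "e = omitted v F" by blast
    then show ?thesis
    proof cases
      case 1
      then show ?thesis using ge by (simp add: inner_add_right mult_nonneg_nonpos)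
    next
      case 2
      have "a F \<bullet> x = b F" using ab[OF 2(1)] 2(3) by auto
      then have "f (d e) = 0" using val[OF e] adneg[OF e] GF[OF 2(1,2)] 2(4) by simp
      then show ?thesis by simp
    qed
  qed
  then have "c \<bullet> (x - v) \<le> 0" unfolding eq inner_sum_right by (simp add: sum_nonpos)
  then show ?thesis by (simp add: inner_diff_right)
qed

end

section \<open>Euler's formula for simple polytopes\<close>

lemma exists_inner_inj_on:
  fixes S :: "'a::euclidean_space set"
  assumes "finite S"
  obtains c where "inj_on (\<lambda>x. c \<bullet> x) S"
proof -
  let ?N = "\<Union>(x, y)\<in>{(x, y)\<in>S \<times> S. x \<noteq> y}. {c. (x - y) \<bullet> c = 0}"
  have fin: "finite {(x, y)\<in>S \<times> S. x \<noteq> y}"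
    by (rule finite_subset[of _ "S \<times> S"]) (use assms in auto)
  have "negligible ?N"
  proof (rule negligible_Union)
    show "finite ((\<lambda>(x, y). {c. (x - y) \<bullet> c = 0}) ` {(x, y)\<in>S \<times> S. x \<noteq> y})"
      by (rule finite_imageI[OF fin])
  qed (auto simp: negligible_hyperplane)
  then have "?N \<noteq> UNIV" using non_negligible_UNIV by metis
  then obtain c where "c \<notin> ?N" by blast
  then have "inj_on (\<lambda>x. c \<bullet> x) S"
    by (auto simp: inj_on_def inner_diff_left inner_commute[of c])
  then show thesis using that by blast
qed

lemma card_Max_inj_on:
  fixes f :: "'a \<Rightarrow> 'b::linorder"
  assumes "finite X" "X \<noteq> {}" "inj_on f X"
  shows "card {v \<in> X. \<forall>u\<in>X. f u \<le> f v} = 1"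
proof -
  have "Max (f ` X) \<in> f ` X" using assms by (intro Max_in) auto
  then obtain m where m: "m \<in> X" "f m = Max (f ` X)" by auto
  have "{v \<in> X. \<forall>u\<in>X. f u \<le> f v} = {m}"
  proof (intro equalityI subsetI)
    fix v assume "v \<in> {v \<in> X. \<forall>u\<in>X. f u \<le> f v}"
    then have "v \<in> X" "f m \<le> f v" "f v \<le> f m" using m assms by auto
    then show "v \<in> {m}" using assms(3) m(1) by (auto dest: inj_onD)
  qed (use m assms in auto)
  then show ?thesis by simp
qed

text \<open>In a set of three elements \<open>e\<close> corresponds to the pair
  \<open>S - {e}\<close>, so the count is that of the pairs inside \<open>D\<close>. Applied to the
  edges at a vertex, with \<open>D\<close> the descending ones.\<close>

lemma card_all_but_one_subset:
  assumes S: "card S = 3" and D: "D \<subseteq> S"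
  shows "card {e \<in> S. S - {e} \<subseteq> D} = card D choose 2"
proof -
  have fin: "finite S" using S by (simp add: card_ge_0_finite)
  have cD: "card (S - D) = 3 - card D" using S D fin by (simp add: card_Diff_subset finite_subset)
  have eq: "{e \<in> S. S - {e} \<subseteq> D} = {e \<in> S. S - D \<subseteq> {e}}" by auto
  have "card D \<le> 3" using card_mono[OF fin D] S by simp
  then consider "card D = 3" | "card D = 2" | "card D < 2" by linarith
  then show ?thesis
  proof cases
    case 1
    then have "D = S" using fin D S by (simp add: card_subset_eq)
    then show ?thesis using S 1 by (simp add: numeral_eq_Suc)
  next
    case 2
    then obtain x where "S - D = {x}" using cD by (auto simp: card_1_singleton_iff)
    then have "{e \<in> S. S - {e} \<subseteq> D} = {x}" unfolding eq by auto
    then show ?thesis using 2 by simp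
  next
    case 3
    then have "card (S - D) \<ge> 2" using cD by simp
    then have "{e \<in> S. S - D \<subseteq> {e}} = {}"
      using card_mono[of "{e}" "S - D" for e] by force
    then show ?thesis using 3 by (simp only: eq card.empty binomial_eq_0)
  qed
qed

lemma (in polytope3) sum_card_star: "(\<Sum>v\<in>verts. card (star v)) = 2 * card segs"
proof -
  have "(\<Sum>v\<in>verts. card {e \<in> segs. v \<in> e}) = (\<Sum>e\<in>segs. 2)"
    using card_seg_verts by (intro sum_multicount_gen ballI) auto
  then show ?thesis by (simp add: star_def)
qed

locale simple_polytope3 = polytope3 +
  assumes card_star: "v \<in> verts \<Longrightarrow> card (star v) = 3"
begin

text \<open>The inequality is weak because \<open>v\<close> is itself an end of \<open>e\<close>; if
  \<open>c\<close> is injective on the vertices, it is strict at the other end.\<close>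

definition down where "down c v = {e \<in> star v. \<forall>u\<in>e \<inter> verts. c \<bullet> u \<le> c \<bullet> v}"

lemma verts_subset: "verts \<subseteq> P"
  by (auto simp: verts_def extreme_point_of_def)

text \<open>A local maximum on a facet is global on it. The omitted edge may well ascend: its cone
  coordinate is zero on \<open>F\<close>.\<close>

lemma facet_max_iff:
  assumes v: "v \<in> verts" and F: "F \<in> facets" "v \<in> F"
  shows "(\<forall>u\<in>F \<inter> verts. c \<bullet> u \<le> c \<bullet> v) \<longleftrightarrow> star v - {omitted v F} \<subseteq> down c v"
proof
  assume "\<forall>u\<in>F \<inter> verts. c \<bullet> u \<le> c \<bullet> v"
  then show "star v - {omitted v F} \<subseteq> down c v"
    using omitted_props(2)[OF v card_star[OF v] F] by (auto simp: down_def)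
next
  assume sub: "star v - {omitted v F} \<subseteq> down c v"
  show "\<forall>u\<in>F \<inter> verts. c \<bullet> u \<le> c \<bullet> v"
  proof
    fix x assume x: "x \<in> F \<inter> verts"
    show "c \<bullet> x \<le> c \<bullet> v"
    proof (rule simple_vertex_local_max[OF v card_star[OF v]])
      fix e u assume e: "e \<in> star v" "u \<in> e \<inter> verts"
      then show "c \<bullet> u \<le> c \<bullet> v \<or> (\<exists>F\<in>facets. v \<in> F \<and> x \<in> F \<and> e = omitted v F)"
        using sub F x by (cases "e = omitted v F") (auto simp: down_def)
    qed (use x verts_subset in auto)
  qed
qed

lemma max_iff:
  assumes v: "v \<in> verts"
  shows "(\<forall>u\<in>verts. c \<bullet> u \<le> c \<bullet> v) \<longleftrightarrow> down c v = star v"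
proof
  assume eq: "down c v = star v"
  show "\<forall>u\<in>verts. c \<bullet> u \<le> c \<bullet> v"
  proof
    fix x assume x: "x \<in> verts"
    show "c \<bullet> x \<le> c \<bullet> v"
    proof (rule simple_vertex_local_max[OF v card_star[OF v]])
      fix e u assume "e \<in> star v" "u \<in> e \<inter> verts"
      then show "c \<bullet> u \<le> c \<bullet> v \<or> (\<exists>F\<in>facets. v \<in> F \<and> x \<in> F \<and> e = omitted v F)"
        unfolding eq[symmetric] by (auto simp: down_def)
    qed (use x verts_subset in auto)
  qed
qed (auto simp: down_def)

text \<open>For generic \<open>c\<close> every edge at \<open>v\<close> either descends or ascends,
  so the bottom vertex can be treated as the top vertex for \<open>- c\<close>.\<close>

lemma down_uminus:
  assumes v: "v \<in> verts" and inj: "inj_on (\<lambda>x. c \<bullet> x) verts"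
  shows "down (- c) v = star v - down c v"
proof -
  have "e \<in> down (- c) v \<longleftrightarrow> e \<notin> down c v" if e: "e \<in> star v" for e
  proof -
    obtain s t where st: "s \<noteq> t" "e \<inter> verts = {s, t}"
      using segment_ends[of e] e unfolding star_def by (metis (no_types, lifting) mem_Collect_eq)
    then have "c \<bullet> s \<noteq> c \<bullet> t" using inj by (auto dest: inj_onD)
    moreover have "v = s \<or> v = t" using e v st by (auto simp: star_def)
    ultimately show ?thesis using e st by (auto simp: down_def)
  qed
  then show ?thesis by (auto simp: down_def)
qed

text \<open>Sweep by a generic linear functional: a vertex with \<open>k\<close> descending edges is the top of
  \<open>k choose 2\<close> facets, and \<open>(k choose 2) + 1 = k\<close> except at the top and at the bottom vertex.\<close>

theorem euler_simple: "card facets + card verts = card segs + 2"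
proof -
  obtain c where inj: "inj_on (\<lambda>x. c \<bullet> x) verts"
    using exists_inner_inj_on[OF finite_verts] .
  define k where "k = (\<lambda>v. card (down c v))"
  have down_star: "down d v \<subseteq> star v" for d v by (auto simp: down_def)
  have k3: "k v \<le> 3" if "v \<in> verts" for v
    using card_mono[OF finite_star down_star[of c v]] card_star[OF that] by (simp add: k_def)
  have ne: "verts \<noteq> {}"
    using polytope_facet_exists[OF polytope] aff_dim3 facet_has_vertex by (force simp: facets_def)
  have facet_count: "(\<Sum>v\<in>verts. k v choose 2) = card facets"
  proof -
    have "(\<Sum>v\<in>verts. card {F \<in> facets. v \<in> F \<and> (\<forall>u\<in>F \<inter> verts. c \<bullet> u \<le> c \<bullet> v)}) = (\<Sum>F\<in>facets. 1)"
    proof (intro sum_multicount_gen ballI)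
      fix F assume F: "F \<in> facets"
      have "{v \<in> verts. v \<in> F \<and> (\<forall>u\<in>F \<inter> verts. c \<bullet> u \<le> c \<bullet> v)}
        = {v \<in> F \<inter> verts. \<forall>u\<in>F \<inter> verts. c \<bullet> u \<le> c \<bullet> v}" by auto
      then show "card {v \<in> verts. v \<in> F \<and> (\<forall>u\<in>F \<inter> verts. c \<bullet> u \<le> c \<bullet> v)} = 1"
        using card_Max_inj_on[of "F \<inter> verts" "\<lambda>x. c \<bullet> x"] inj facet_has_vertex[OF F]
        by (auto intro: inj_on_subset)
    qed auto
    moreover have "card {F \<in> facets. v \<in> F \<and> (\<forall>u\<in>F \<inter> verts. c \<bullet> u \<le> c \<bullet> v)} = k v choose 2"
      if v: "v \<in> verts" for v
    proof -
      \<comment> \<open>\<open>v\<close> is the top of a facet exactly if both edges of the facet at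
        \<open>v\<close> descend, so the facets with top \<open>v\<close> correspond to pairs of
        descending edges.\<close>
      have "bij_betw (omitted v) {F \<in> {F \<in> facets. v \<in> F}. star v - {omitted v F} \<subseteq> down c v}
        {e \<in> star v. star v - {e} \<subseteq> down c v}"
        by (rule bij_betw_Collect[OF bij_betw_omitted[OF v card_star[OF v]]]) simp
      moreover have "{F \<in> {F \<in> facets. v \<in> F}. star v - {omitted v F} \<subseteq> down c v}
        = {F \<in> facets. v \<in> F \<and> (\<forall>u\<in>F \<inter> verts. c \<bullet> u \<le> c \<bullet> v)}"
        using facet_max_iff[OF v] by auto
      ultimately show ?thesis
        using card_all_but_one_subset[OF card_star[OF v] down_star] bij_betw_same_card by (fastforce simp: k_def)
    qed
    ultimately show ?thesis by simp
  qed
  have seg_count: "(\<Sum>v\<in>verts. k v) = card segs"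
  proof -
    have "(\<Sum>v\<in>verts. card {e \<in> segs. v \<in> e \<and> (\<forall>u\<in>e \<inter> verts. c \<bullet> u \<le> c \<bullet> v)}) = (\<Sum>e\<in>segs. 1)"
    proof (intro sum_multicount_gen ballI)
      fix e assume e: "e \<in> segs"
      have "{v \<in> verts. v \<in> e \<and> (\<forall>u\<in>e \<inter> verts. c \<bullet> u \<le> c \<bullet> v)}
        = {v \<in> e \<inter> verts. \<forall>u\<in>e \<inter> verts. c \<bullet> u \<le> c \<bullet> v}" by auto
      moreover have "e \<inter> verts \<noteq> {}" using segment_ends[OF e] by blast
      ultimately show "card {v \<in> verts. v \<in> e \<and> (\<forall>u\<in>e \<inter> verts. c \<bullet> u \<le> c \<bullet> v)} = 1"
        using card_Max_inj_on[of "e \<inter> verts" "\<lambda>x. c \<bullet> x"] inj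
        by (auto intro: inj_on_subset)
    qed auto
    moreover have "down c v = {e \<in> segs. v \<in> e \<and> (\<forall>u\<in>e \<inter> verts. c \<bullet> u \<le> c \<bullet> v)}" for v
      by (auto simp: down_def star_def)
    ultimately show ?thesis by (simp add: k_def)
  qed
  have top: "card {v \<in> verts. k v = 3} = 1"
  proof -
    have "k v = 3 \<longleftrightarrow> (\<forall>u\<in>verts. c \<bullet> u \<le> c \<bullet> v)" if v: "v \<in> verts" for v
      unfolding max_iff[OF v] k_def using card_star[OF v] card_subset_eq[OF finite_star down_star, of c v] 
      by metis
    then have "{v \<in> verts. k v = 3} = {v \<in> verts. \<forall>u\<in>verts. c \<bullet> u \<le> c \<bullet> v}" by auto
    then show ?thesis using card_Max_inj_on[OF finite_verts ne inj] by simp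
  qed
  have bot: "card {v \<in> verts. k v = 0} = 1"
  proof -
    have "k v = 0 \<longleftrightarrow> (\<forall>u\<in>verts. - c \<bullet> u \<le> - c \<bullet> v)" if v: "v \<in> verts" for v
      using max_iff[OF v, of "- c"] down_uminus[OF v inj] down_star[of c v]
      by (auto simp: k_def finite_subset[OF down_star])
    then have eq: "{v \<in> verts. k v = 0} = {v \<in> verts. \<forall>u\<in>verts. - c \<bullet> u \<le> - c \<bullet> v}" by blast
    have "inj_on (\<lambda>x. - c \<bullet> x) verts" using inj by (simp add: inj_on_def)
    from card_Max_inj_on[OF finite_verts ne this] show ?thesis unfolding eq .
  qed
  \<comment> \<open>For \<open>k v = 0, 1, 2, 3\<close> both sides are 1, 1, 2, 4. The corrections
    at 0 and 3 occur at one vertex each and add up to the 2 in Euler's formula.\<close>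
  have "(\<Sum>v\<in>verts. (k v choose 2) + 1) = (\<Sum>v\<in>verts. k v + of_bool (k v = 0) + of_bool (k v = 3))"
  proof (rule sum.cong[OF refl])
    fix v assume "v \<in> verts"
    then consider "k v = 0" | "k v = 1" | "k v = 2" | "k v = 3" using k3[of v] by linarith
    then show "(k v choose 2) + 1 = k v + of_bool (k v = 0) + of_bool (k v = 3)"
      by cases (simp_all add: numeral_eq_Suc)
  qed
  moreover have "(\<Sum>v\<in>verts. of_bool (k v = j)) = card {v \<in> verts. k v = j}" for j
    by (simp add: of_bool_def sum.If_cases Int_def)
  ultimately show ?thesis
    using facet_count seg_count top bot unfolding sum.distrib by simp
qed

section \<open>Facet sizes and the bipartite case\<close>

definition facet_segs where "facet_segs F = {e \<in> segs. e \<subseteq> F}"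

text \<open>Double counting on the boundary of the polygon \<open>F\<close>. The set
  \<open>X\<close> is either all vertices, with \<open>k = 2\<close>, or one colour class, with
  \<open>k = 1\<close>.\<close>

lemma card_facet_segs:
  assumes F: "F \<in> facets" and X: "X \<subseteq> verts"
    and k: "\<And>e. e \<in> facet_segs F \<Longrightarrow> card {v \<in> F \<inter> X. v \<in> e} = k"
  shows "2 * card (F \<inter> X) = k * card (facet_segs F)"
proof -
  have "(\<Sum>v\<in>F \<inter> X. card {e \<in> facet_segs F. v \<in> e}) = (\<Sum>e\<in>facet_segs F. k)"
  proof (intro sum_multicount_gen ballI)
    show "finite (F \<inter> X)" using X finite_subset[of "F \<inter> X" verts] by auto
    show "finite (facet_segs F)" by (simp add: facet_segs_def)
  qed (use k in auto)
  moreover have "card {e \<in> facet_segs F. v \<in> e} = 2" if "v \<in> F \<inter> X" for v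
  proof -
    have "{e \<in> facet_segs F. v \<in> e} = {e \<in> star v. e \<subseteq> F}" by (auto simp: facet_segs_def star_def)
    then show ?thesis using card_segs_facet[OF F] that X by auto
  qed
  ultimately show ?thesis by (simp add: mult.commute)
qed

lemma card_facet_verts:
  assumes F: "F \<in> facets"
  shows "card (F \<inter> verts) = card (facet_segs F)"
proof -
  have "card {v \<in> F \<inter> verts. v \<in> e} = 2" if "e \<in> facet_segs F" for e
  proof -
    have "{v \<in> F \<inter> verts. v \<in> e} = {v \<in> verts. v \<in> e}" using that by (auto simp: facet_segs_def)
    then show ?thesis using card_seg_verts that by (simp add: facet_segs_def)
  qed
  then have "2 * card (F \<inter> verts) = 2 * card (facet_segs F)"
    by (intro card_facet_segs[OF F]) auto
  then show ?thesis by simp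
qed

lemma sum_card_facet_verts: "(\<Sum>F\<in>facets. card (F \<inter> verts)) = 3 * card verts"
proof -
  have "(\<Sum>F\<in>facets. card {v \<in> verts. v \<in> F}) = (\<Sum>v\<in>verts. 3)"
    using card_facets_vertex card_star by (intro sum_multicount_gen ballI) auto
  moreover have "{v \<in> verts. v \<in> F} = F \<inter> verts" for F by auto
  ultimately show ?thesis by simp
qed

lemma card_verts_segs: "3 * card verts = 2 * card segs"
  using sum_card_star card_star by simp

text \<open>Every edge of \<open>F\<close> has one end in \<open>A\<close>, so half of the vertices
  of \<open>F\<close> lie in \<open>A\<close>. Two vertices are too few, since two different edges
  would have the same ends.\<close>

lemma bipartite_facet:
  assumes AB: "A \<union> B = verts" "A \<inter> B = {}" 
    and bip: "\<And>e. e \<in> segs \<Longrightarrow> \<exists>a\<in>A. \<exists>b\<in>B. e \<inter> verts = {a, b}"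
    and F: "F \<in> facets"
  shows "even (card (F \<inter> verts))" "card (F \<inter> verts) \<ge> 4"
proof -
  have "card {v \<in> F \<inter> A. v \<in> e} = 1" if e: "e \<in> facet_segs F" for e
  proof -
    have e: "e \<in> segs" "e \<subseteq> F" using e by (auto simp: facet_segs_def)
    obtain a b where ab: "a \<in> A" "b \<in> B" "e \<inter> verts = {a, b}" using bip[OF e(1)] by blast
    have "{v \<in> F \<inter> A. v \<in> e} = (e \<inter> verts) \<inter> A" using e(2) AB by auto
    also have "\<dots> = {a}" using ab AB by auto
    finally show ?thesis by simp
  qed
  then have "2 * card (F \<inter> A) = card (facet_segs F)"
    using card_facet_segs[OF F, of A 1] AB by auto
  then have eq: "card (F \<inter> verts) = 2 * card (F \<inter> A)" using card_facet_verts[OF F] by simp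
  then show "even (card (F \<inter> verts))" by simp
  have "F \<inter> verts \<noteq> {}" using facet_has_vertex[OF F] by auto
  then have "card (F \<inter> verts) > 0" by (simp add: card_gt_0_iff)
  moreover have "card (F \<inter> verts) \<noteq> 2"
  proof
    assume c2: "card (F \<inter> verts) = 2"
    then have "card (facet_segs F) = 2" using card_facet_verts[OF F] by simp
    then obtain e e' where e: "facet_segs F = {e, e'}" "e \<noteq> e'" by (auto simp: card_2_iff)
    then have seg: "e \<in> segs" "e' \<in> segs" "e \<subseteq> F" "e' \<subseteq> F" unfolding facet_segs_def by blast+
    have all: "d \<inter> verts = F \<inter> verts" if d: "d \<in> segs" "d \<subseteq> F" for d
    proof (rule card_subset_eq)
      have "{v \<in> verts. v \<in> d} = d \<inter> verts" by auto
      then show "card (d \<inter> verts) = card (F \<inter> verts)" using card_seg_verts[OF d(1)] c2 by simp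
    qed (use d in auto)
    obtain s t where st: "s \<noteq> t" "e \<inter> verts = {s, t}" using segment_ends[OF seg(1)] by metis
    then have "e' \<inter> verts = {s, t}" using all seg by auto
    then have "s \<in> verts" "t \<in> verts" "s \<in> e" "t \<in> e" "s \<in> e'" "t \<in> e'" using st by blast+
    then show False using seg_eqI[OF seg(1,2) st(1)] e(2) by blast
  qed
  ultimately show "card (F \<inter> verts) \<ge> 4" using eq by (cases "card (F \<inter> A)") (auto simp: numeral_eq_Suc)
qed

text \<open>There are seven facets, of even sizes with sum 30, hence one hexagon \<open>H\<close> surrounded by six
  quadrilaterals. A vertex off \<open>H\<close> with two neighbours off \<open>H\<close> would yield a quadrilateral with three
  vertices off \<open>H\<close>, so at least eight edges end on \<open>H\<close>; but only one edge per vertex of \<open>H\<close> leaves \<open>H\<close>.\<close>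

theorem not_bipartite_10:
  assumes V: "card verts = 10"
    and AB: "A \<union> B = verts" "A \<inter> B = {}" 
    and bip: "\<And>e. e \<in> segs \<Longrightarrow> \<exists>a\<in>A. \<exists>b\<in>B. e \<inter> verts = {a, b}"
  shows False
proof -
  \<comment> \<open>Degree three gives \<open>3 * 10 = 2 * 15\<close>, and Euler's formula gives
    \<open>15 + 2 - 10\<close>.\<close>
  have seven: "card facets = 7" using euler_simple card_verts_segs V by simp
  have ge4: "card (F \<inter> verts) \<ge> 4" and ev: "even (card (F \<inter> verts))" if "F \<in> facets" for F
    using bipartite_facet[OF AB bip that] by auto
  have "\<exists>H\<in>facets. card (H \<inter> verts) \<noteq> 4"
  proof (rule ccontr)
    assume "\<not> ?thesis"
    then have "(\<Sum>F\<in>facets. card (F \<inter> verts)) = (\<Sum>F\<in>facets. 4)" by (intro sum.cong) auto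
    then show False using sum_card_facet_verts V seven by simp
  qed
  then obtain H where H: "H \<in> facets" "card (H \<inter> verts) \<noteq> 4" by auto
  have ge6: "card (F \<inter> verts) \<ge> 6" if "F \<in> facets" "card (F \<inter> verts) \<noteq> 4" for F
    using ge4[OF that(1)] ev[OF that(1)] that(2) by (auto elim!: evenE)
  have rest: "(\<Sum>F\<in>facets - {H}. card (F \<inter> verts)) + card (H \<inter> verts) = 30"
    using sum_card_facet_verts V H(1) by (simp add: sum.remove[of facets H])
  have four: "card (Q \<inter> verts) = 4" if Q: "Q \<in> facets" "Q \<noteq> H" for Q
  proof (rule ccontr)
    assume n4: "card (Q \<inter> verts) \<noteq> 4"
    \<comment> \<open>Two facets of size at least 6 and five of size at least 4 would need 32
      incidences, but there are 30.\<close>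
    have c5: "card (facets - {H} - {Q}) = 5" using H Q seven by simp
    have "(\<Sum>F\<in>facets - {H} - {Q}. 4) \<le> (\<Sum>F\<in>facets - {H} - {Q}. card (F \<inter> verts))"
      using ge4 by (intro sum_mono) auto
    then have "20 \<le> (\<Sum>F\<in>facets - {H} - {Q}. card (F \<inter> verts))" using c5 by simp
    moreover have "(\<Sum>F\<in>facets - {H}. card (F \<inter> verts)) = card (Q \<inter> verts) + (\<Sum>F\<in>facets - {H} - {Q}. card (F \<inter> verts))"
      using Q by (intro sum.remove) auto
    ultimately show False using rest ge6[OF Q(1) n4] ge6[OF H] by linarith
  qed
  have c6: "card (facets - {H}) = 6" using H seven by simp
  have "(\<Sum>F\<in>facets - {H}. card (F \<inter> verts)) = (\<Sum>F\<in>facets - {H}. 4)"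
    using four by (intro sum.cong) auto
  then have H6: "card (H \<inter> verts) = 6" using rest c6 by simp
  \<comment> \<open>Each of the six edges of \<open>H\<close> lies on exactly one other facet, and
    each other facet contains at most one of them. If \<open>Q\<close> contained none, the remaining
    five facets could not account for six edges.\<close>
  have share: "\<exists>e\<in>facet_segs H. e \<subseteq> Q" if Q: "Q \<in> facets" "Q \<noteq> H" for Q
  proof (rule ccontr)
    assume none: "\<not> ?thesis"
    have "(\<Sum>F\<in>facets - {H}. card {e \<in> facet_segs H. e \<subseteq> F}) = (\<Sum>e\<in>facet_segs H. 1)"
    proof (intro sum_multicount_gen ballI)
      fix e assume "e \<in> facet_segs H"
      then have e: "e \<in> segs" "e \<subseteq> H" by (auto simp: facet_segs_def)
      have "{F \<in> facets - {H}. e \<subseteq> F} = {F \<in> facets. e \<subseteq> F} - {H}" by auto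
      then show "card {F \<in> facets - {H}. e \<subseteq> F} = 1"
        using card_facets_seg[OF e(1)] e(2) H(1) by simp
    qed (auto simp: facet_segs_def)
    then have "(\<Sum>F\<in>facets - {H}. card {e \<in> facet_segs H. e \<subseteq> F}) = 6"
      using H6 card_facet_verts[OF H(1)] by simp
    moreover have "(\<Sum>F\<in>facets - {H}. card {e \<in> facet_segs H. e \<subseteq> F})
      = card {e \<in> facet_segs H. e \<subseteq> Q} + (\<Sum>F\<in>facets - {H} - {Q}. card {e \<in> facet_segs H. e \<subseteq> F})"
      using Q by (intro sum.remove) auto
    moreover have "{e \<in> facet_segs H. e \<subseteq> Q} = {}" using none by auto
    moreover have "(\<Sum>F\<in>facets - {H} - {Q}. card {e \<in> facet_segs H. e \<subseteq> F}) \<le> (\<Sum>F\<in>facets - {H} - {Q}. 1)"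
    proof (rule sum_mono)
      fix F assume F: "F \<in> facets - {H} - {Q}"
      have "e = e'" if "e \<in> {e \<in> facet_segs H. e \<subseteq> F}" "e' \<in> {e \<in> facet_segs H. e \<subseteq> F}" for e e'
        using facets_share_seg[of H F e e'] H(1) F that by (auto simp: facet_segs_def)
      then show "card {e \<in> facet_segs H. e \<subseteq> F} \<le> 1"
        by (simp add: card_le_Suc0_iff_eq facet_segs_def)
    qed
    moreover have "card (facets - {H} - {Q}) = 5" using H Q seven by simp
    ultimately show False by simp
  qed
  \<comment> \<open>The edges between \<open>H\<close> and its complement, counted from both ends:
    at most one per vertex of \<open>H\<close>, at least two per vertex off
    \<open>H\<close>.\<close>
  define X where "X = {e \<in> segs. (\<exists>h\<in>H \<inter> verts. h \<in> e) \<and> (\<exists>r\<in>verts - H. r \<in> e)}"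
  have finX: "finite X" by (simp add: X_def)
  have X1: "card {v \<in> H \<inter> verts. v \<in> e} = 1 \<and> card {v \<in> verts - H. v \<in> e} = 1" if "e \<in> X" for e
  proof -
    have "e \<in> segs" "\<exists>h\<in>H \<inter> verts. h \<in> e" "\<exists>r\<in>verts - H. r \<in> e" 
      using that by (simp_all add: X_def)
    then obtain h r where hr: "h \<in> H" "h \<in> verts" "h \<in> e" "r \<in> verts" "r \<notin> H" "r \<in> e" "e \<in> segs"
      by blast
    obtain s t where st: "s \<noteq> t" "e \<inter> verts = {s, t}" using segment_ends[OF hr(7)] by metis
    have "h \<in> e \<inter> verts" "r \<in> e \<inter> verts" using hr by auto
    then have eq: "e \<inter> verts = {h, r}" using st hr(1,5) by auto
    have "{v \<in> H \<inter> verts. v \<in> e} = (e \<inter> verts) \<inter> H" "{v \<in> verts - H. v \<in> e} = (e \<inter> verts) - H" by auto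
    then have "{v \<in> H \<inter> verts. v \<in> e} = {h}" "{v \<in> verts - H. v \<in> e} = {r}" using eq hr by auto
    then show ?thesis by simp
  qed
  have starX: "{e \<in> X. v \<in> e} = star v \<inter> X" for v by (auto simp: X_def star_def)
  have "(\<Sum>v\<in>H \<inter> verts. card {e \<in> X. v \<in> e}) = (\<Sum>e\<in>X. 1)"
    using X1 finX by (intro sum_multicount_gen ballI) auto
  moreover have "(\<Sum>v\<in>H \<inter> verts. card {e \<in> X. v \<in> e}) \<le> (\<Sum>v\<in>H \<inter> verts. 1)"
  proof (rule sum_mono)
    fix v assume v: "v \<in> H \<inter> verts"
    have "star v \<inter> X \<subseteq> star v - {e \<in> star v. e \<subseteq> H}" by (auto simp: X_def)
    then have "card (star v \<inter> X) \<le> card (star v - {e \<in> star v. e \<subseteq> H})" by (intro card_mono) auto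
    also have "\<dots> = card (star v) - card {e \<in> star v. e \<subseteq> H}" by (intro card_Diff_subset) auto
    also have "\<dots> = 1" using card_star card_segs_facet[OF H(1)] v by auto
    finally show "card {e \<in> X. v \<in> e} \<le> 1" by (simp add: starX)
  qed
  ultimately have le6: "card X \<le> 6" using H6 by simp
  have "(\<Sum>v\<in>verts - H. card {e \<in> X. v \<in> e}) = (\<Sum>e\<in>X. 1)"
    using X1 finX by (intro sum_multicount_gen ballI) auto
  moreover have "(\<Sum>v\<in>verts - H. 2) \<le> (\<Sum>v\<in>verts - H. card {e \<in> X. v \<in> e})"
  proof (rule sum_mono)
    fix r assume r: "r \<in> verts - H"
    have "\<not> card (star r - X) \<ge> 2"
    proof
      assume "card (star r - X) \<ge> 2"
      then obtain D where "D \<subseteq> star r - X" "card D = 2" by (meson obtain_subset_with_card_n)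
      then obtain e1 e2 where e: "e1 \<in> star r" "e2 \<in> star r" "e1 \<notin> X" "e2 \<notin> X" "e1 \<noteq> e2"
        by (auto simp: card_2_iff)
      have "\<exists>e3 \<in> star r. e3 \<noteq> e1 \<and> e3 \<noteq> e2"
      proof (rule ccontr)
        assume "\<not> ?thesis"
        then have "star r \<subseteq> {e1, e2}" by auto
        then have "card (star r) \<le> card {e1, e2}" by (intro card_mono) auto
        then show False using card_star[of r] r e(5) by simp
      qed
      then obtain e3 where e3: "e3 \<in> star r" "e3 \<noteq> e1" "e3 \<noteq> e2" by auto
      have rv: "r \<in> verts" "r \<notin> H" using r by auto
      \<comment> \<open>The facet that omits the third edge at \<open>r\<close> contains both
        \<open>e1\<close> and \<open>e2\<close>.\<close>
      have "e3 \<in> omitted r ` {F \<in> facets. r \<in> F}"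
        using bij_betw_omitted[OF rv(1) card_star[OF rv(1)]] e3(1) by (simp add: bij_betw_def)
      then obtain F where F: "F \<in> facets" "r \<in> F" "omitted r F = e3" by auto
      have "e1 \<in> {e \<in> star r. e \<subseteq> F}" "e2 \<in> {e \<in> star r. e \<subseteq> F}"
        using omitted_props(2)[OF rv(1) card_star[OF rv(1)] F(1,2)] F(3) e3 e by auto
      then have sub: "e1 \<subseteq> F" "e2 \<subseteq> F" by auto
      have other: "\<exists>u. u \<noteq> r \<and> u \<in> d \<inter> verts \<and> u \<notin> H" if d: "d \<in> star r" "d \<notin> X" for d
      proof -
        have ds: "d \<in> segs" "r \<in> d" using d by (auto simp: star_def)
        obtain s t where st: "s \<noteq> t" "d \<inter> verts = {s, t}" using segment_ends[OF ds(1)] by metis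
        then obtain u where u: "u \<noteq> r" "u \<in> d \<inter> verts" by (metis insertI1 insert_commute)
        then have "u \<notin> H" using d(2) ds r by (auto simp: X_def)
        then show ?thesis using u by auto
      qed
      obtain u1 where u1: "u1 \<noteq> r" "u1 \<in> e1 \<inter> verts" "u1 \<notin> H" using other[OF e(1,3)] by auto
      obtain u2 where u2: "u2 \<noteq> r" "u2 \<in> e2 \<inter> verts" "u2 \<notin> H" using other[OF e(2,4)] by auto
      have u12: "u1 \<noteq> u2" 
        using seg_eqI[of e1 e2 r u1] e u1 u2 rv by (auto simp: star_def)
      have FH: "F \<noteq> H" using F(2) rv by auto
      obtain g where g: "g \<in> segs" "g \<subseteq> H" "g \<subseteq> F" using share[OF F(1) FH] by (auto simp: facet_segs_def)
      obtain s t where st: "s \<noteq> t" "g \<inter> verts = {s, t}" using segment_ends[OF g(1)] by metis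
      then have stv: "s \<in> H" "t \<in> H" "s \<in> F" "t \<in> F" "s \<in> verts" "t \<in> verts" using g by blast+
      \<comment> \<open>The three vertices of \<open>F\<close> off \<open>H\<close> and the two ends
        of the edge shared with \<open>H\<close> are too many for a quadrilateral.\<close>
      have "{r, u1, u2, s, t} \<subseteq> F \<inter> verts" using F rv sub u1 u2 stv by auto
      then have "card {r, u1, u2, s, t} \<le> card (F \<inter> verts)" by (intro card_mono) auto
      moreover have "r \<notin> {u1, u2, s, t}" "u1 \<notin> {u2, s, t}" "u2 \<notin> {s, t}" 
        using stv rv u1 u2 u12 by auto
      then have "card {r, u1, u2, s, t} = 5" using st(1) by simp
      ultimately show False using four[OF F(1) FH] by simp
    qed
    moreover have "card (star r) = card (star r \<inter> X) + card (star r - X)"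
      by (metis card_Un_disjoint finite_Diff finite_Int finite_star Int_Diff_Un Int_Diff_disjoint)
    ultimately show "2 \<le> card {e \<in> X. r \<in> e}" using card_star[of r] r by (simp add: starX)
  qed
  moreover have "card (verts - H) = 4"
  proof -
    have "card (verts - (H \<inter> verts)) = card verts - card (H \<inter> verts)" by (intro card_Diff_subset) auto
    moreover have "verts - (H \<inter> verts) = verts - H" by auto
    ultimately show ?thesis using V H6 by simp
  qed
  ultimately show False using le6 by simp
qed

end

text \<open>The degrees are at least 3 and sum to \<open>2 * 15 = 3 * 10\<close>, so all of them
  equal 3. The rest transports vertices, edges and the bipartition along the isomorphism.\<close>

lemma polyhedral_not_bipartite_10_15:
  fixes V :: "'a set"
  assumes "polyhedral_graph V E" "bipartite V E" "card V = 10" "card E = 15"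
  shows False
proof -
  obtain P f where sg: "simple_graph V E" and P: "polytope P" "aff_dim P = 3"
    and iso: "bij_betw f V (polytope_vertices P)" "(\<lambda>e. f ` e) ` E = polytope_edges P"
    using assms(1) by (auto simp: polyhedral_graph_def graph_isomorphism_def)
  interpret polytope3 P by unfold_locales (use P in auto)
  have verts: "polytope_vertices P = verts" by (simp add: polytope_vertices_def verts_def)
  have edges: "polytope_edges P = (\<lambda>e. e \<inter> verts) ` segs"
  proof (intro equalityI subsetI)
    fix d assume "d \<in> polytope_edges P"
    then obtain x y where d: "d = {x, y}" "closed_segment x y edge_of P" by (auto simp: polytope_edges_def)
    then have "closed_segment x y \<inter> verts = {x, y}"
      using extreme_point_of_face[of "closed_segment x y" P] extreme_point_of_segment[of _ x y]
      by (auto simp: edge_of_def verts_def)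
    then show "d \<in> (\<lambda>e. e \<inter> verts) ` segs" using d by (auto simp: segs_def)
  next
    fix d assume "d \<in> (\<lambda>e. e \<inter> verts) ` segs"
    then obtain e where e: "e \<in> segs" "d = e \<inter> verts" by auto
    then obtain x y where "e = closed_segment x y" "d = {x, y}" by (metis segment_ends)
    then show "d \<in> polytope_edges P" using e(1) by (auto simp: polytope_edges_def segs_def)
  qed
  have "inj_on (\<lambda>e. e \<inter> verts) segs"
  proof (rule inj_onI)
    fix e e' assume e: "e \<in> segs" "e' \<in> segs" "e \<inter> verts = e' \<inter> verts"
    obtain x y where xy: "x \<noteq> y" "e \<inter> verts = {x, y}" using segment_ends[OF e(1)] by metis
    then have "x \<in> e \<inter> verts" "y \<in> e \<inter> verts" "x \<in> e' \<inter> verts" "y \<in> e' \<inter> verts" using e(3) by auto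
    then show "e = e'" using seg_eqI[OF e(1,2) xy(1)] by blast
  qed
  then have "card segs = card (polytope_edges P)" by (simp add: edges card_image)
  also have "\<dots> = card E"
    unfolding iso(2)[symmetric]
  proof (rule card_image)
    have "E \<subseteq> Pow V" using sg by (auto simp: simple_graph_def)
    moreover have "inj_on f V" using iso(1) by (simp add: bij_betw_def)
    ultimately show "inj_on ((`) f) E" by (meson inj_on_image_Pow inj_on_subset)
  qed
  finally have c15: "card segs = 15" using assms(4) by simp
  have c10: "card verts = 10" using iso(1) assms(3) verts bij_betw_same_card by fastforce
  have "card (star v) = 3" if v: "v \<in> verts" for v
  proof -
    have "(\<Sum>w\<in>verts - {v}. 3) \<le> (\<Sum>w\<in>verts - {v}. card (star w))"
      using card_star_ge3 by (intro sum_mono) auto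
    moreover have "(\<Sum>w\<in>verts. card (star w)) = card (star v) + (\<Sum>w\<in>verts - {v}. card (star w))"
      using v by (intro sum.remove) auto
    ultimately show ?thesis using sum_card_star c15 c10 card_star_ge3[OF v] v by simp
  qed
  then interpret simple_polytope3 P by unfold_locales
  obtain A B where AB: "A \<union> B = V" "A \<inter> B = {}" "\<And>e. e \<in> E \<Longrightarrow> \<exists>a\<in>A. \<exists>b\<in>B. e = {a, b}"
    using assms(2) by (auto simp: bipartite_def bipartition_def)
  have "f ` A \<union> f ` B = verts" 
    using AB(1) iso(1) verts by (auto simp: bij_betw_def)
  moreover have "f ` A \<inter> f ` B = {}"
    using AB(1,2) iso(1) inj_on_image_Int[of f V A B] by (auto simp: bij_betw_def)
  moreover have "\<exists>a\<in>f ` A. \<exists>b\<in>f ` B. e \<inter> verts = {a, b}" if "e \<in> segs" for e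
  proof -
    have "e \<inter> verts \<in> (\<lambda>e. f ` e) ` E" using that iso(2) edges by auto
    then obtain d where "d \<in> E" "e \<inter> verts = f ` d" by auto
    then show ?thesis using AB(3)[of d] by auto
  qed
  ultimately show False by (rule not_bipartite_10[OF c10])
qed

section \<open>Jordan curves on the sphere\<close>

text \<open>The model plane is \<open>complex\<close>, the setting of the Jordan curve theorem used
  below.\<close>

lemma punctured_unit_sphere_plane:
  assumes "q \<in> unit_sphere"
  obtains h k where "homeomorphism (unit_sphere - {q}) (UNIV :: complex set) h k"
proof -
  have "(unit_sphere - {q}) homeomorphic (UNIV :: complex set)"
    by (rule homeomorphic_punctured_sphere_affine) (use assms in auto)
  then show thesis using that by (auto simp: homeomorphic_def)
qed

lemma openin_minus_closed:
  assumes "openin (top_of_set S) U" "closed K"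
  shows "openin (top_of_set S) (U - K)"
proof -
  obtain W where "open W" "U = S \<inter> W" using assms(1) by (auto simp: openin_open)
  then have "open (W - K)" "U - K = S \<inter> (W - K)" using assms(2) by auto
  then show ?thesis unfolding openin_open by blast
qed

lemma openin_punctured_unit_sphere: "openin (top_of_set unit_sphere) (unit_sphere - {q})"
  by (intro openin_minus_closed) auto

lemma clopen_eq:
  assumes "connected D" "openin (top_of_set S) F" "F \<noteq> {}" "F \<subseteq> D" "D \<subseteq> S" "closure F \<inter> D \<subseteq> F"
  shows "F = D"
proof -
  have "openin (top_of_set D) F" using assms by (meson openin_subset_trans)
  moreover have "closedin (top_of_set D) F"
    using assms(4,6) closure_subset[of F] by (auto simp: closedin_closed intro!: exI[of _ "closure F"])
  ultimately show ?thesis using assms(1,3) by (auto simp: connected_clopen)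
qed

lemma openin_Int_closure_empty:
  assumes "openin (top_of_set S) U" "F \<subseteq> S" "U \<inter> F = {}"
  shows "U \<inter> closure F = {}"
proof -
  obtain W where W: "open W" "U = S \<inter> W" using assms(1) by (auto simp: openin_open)
  then have "W \<inter> F = {}" using assms(2,3) by auto
  then have "W \<inter> closure F = {}" using W(1) open_Int_closure_eq_empty by blast
  then show ?thesis using W by auto
qed

lemma connected_subset_either:
  assumes "connected F" "openin (top_of_set S) D1" "openin (top_of_set S) D2" "D1 \<inter> D2 = {}" "F \<subseteq> D1 \<union> D2"
  shows "F \<subseteq> D1 \<or> F \<subseteq> D2"
proof (rule ccontr)
  assume "\<not> ?thesis"
  then have "F \<inter> D1 \<noteq> {}" "F \<inter> D2 \<noteq> {}" using assms(5) by auto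
  moreover obtain W1 W2 where "open W1" "D1 = S \<inter> W1" "open W2" "D2 = S \<inter> W2"
    using assms(2,3) by (auto simp: openin_open)
  ultimately show False
    using connectedD[OF assms(1), of W1 W2] assms(4,5) by blast
qed

section \<open>The Jordan curve theorem on the punctured sphere\<close>

locale planar_chart =
  fixes q :: "real^3" and h :: "real^3 \<Rightarrow> complex" and k
  assumes q: "q \<in> unit_sphere" and hk: "homeomorphism (unit_sphere - {q}) UNIV h k"
begin

lemma k_in: "k z \<in> unit_sphere - {q}" and h_k [simp]: "h (k z) = z"
  using hk unfolding homeomorphism_def by blast+

lemma k_h: "x \<in> unit_sphere \<Longrightarrow> x \<noteq> q \<Longrightarrow> k (h x) = x"
  using hk by (auto simp: homeomorphism_def)

lemma inj_h: "inj_on h (unit_sphere - {q})"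
  by (rule inj_on_inverseI[where g = k]) (use k_h in auto)

lemma inj_k: "inj k"
  by (rule inj_on_inverseI[where g = h]) simp

lemma continuous_h: "continuous_on (unit_sphere - {q}) h" and continuous_k: "continuous_on UNIV k"
  using hk by (auto simp: homeomorphism_def)

lemma k_image_h: "X \<subseteq> unit_sphere - {q} \<Longrightarrow> k ` h ` X = X"
  using k_h by (force simp: image_image)

lemma openin_k_image: "open U \<Longrightarrow> openin (top_of_set unit_sphere) (k ` U)"
  using homeomorphism_imp_open_map[OF homeomorphism_symD[OF hk], of U] openin_punctured_unit_sphere openin_trans
  by auto

lemma open_h_image:
  assumes "openin (top_of_set unit_sphere) U" "q \<notin> U"
  shows "open (h ` U)"
proof -
  have "openin (top_of_set (unit_sphere - {q})) U"
    using assms openin_imp_subset[OF assms(1)]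
    by (intro openin_subset_trans[OF assms(1)]) auto
  from homeomorphism_imp_open_map[OF hk this] show ?thesis by simp
qed

lemma k_closure_subset: "k ` closure X \<subseteq> closure (k ` X)"
  using continuous_image_closure_subset[OF continuous_k] by simp

lemma simple_path_h:
  assumes "simple_path g" "path_image g \<subseteq> unit_sphere - {q}"
  shows "simple_path (h \<circ> g)" "path_image (h \<circ> g) = h ` path_image g"
proof -
  show "simple_path (h \<circ> g)"
    using assms continuous_on_subset[OF continuous_h] inj_on_subset[OF inj_h]
    by (intro simple_path_continuous_image) auto
qed (simp add: path_image_compose)

lemma puncture_in_closure:
  assumes "\<not> bounded X"
  shows "q \<in> closure (k ` X)"
proof (rule ccontr)
  assume nq: "q \<notin> closure (k ` X)"
  let ?K = "closure (k ` X)"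
  have sub: "?K \<subseteq> unit_sphere"
    using k_in by (intro closure_minimal) auto
  then have K: "?K \<subseteq> unit_sphere - {q}" using nq by auto
  have "compact ?K" 
    using bounded_subset[OF bounded_sphere sub] by (simp add: compact_eq_bounded_closed)
  then have "compact (h ` ?K)"
    by (rule compact_continuous_image[OF continuous_on_subset[OF continuous_h K]])
  moreover have "X \<subseteq> h ` ?K"
  proof
    fix x assume "x \<in> X"
    then have "k x \<in> ?K" using closure_subset[of "k ` X"] by blast
    then show "x \<in> h ` ?K" using imageI[of "k x" ?K h] by simp
  qed
  ultimately show False using assms bounded_subset[OF compact_imp_bounded] by metis
qed

definition inner where "inner C = k ` inside (h ` C)"
text \<open>The puncture is the point at infinity of the chart and belongs to the unbounded
  side.\<close>

definition outer where "outer C = insert q (k ` outside (h ` C))"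

text \<open>The planar theorem carried over by \<open>k\<close>; only the behaviour of the outer
  side at the puncture needs a separate argument. The closures follow because each side is disjoint
  from the closure of the other, and \<open>C\<close> adheres to both.\<close>

proposition Jordan_sphere:
  assumes g: "simple_path g" "pathfinish g = pathstart g" and C: "path_image g = C" "C \<subseteq> unit_sphere - {q}"
  shows "inner C \<union> outer C = unit_sphere - C" "inner C \<inter> outer C = {}"
    "openin (top_of_set unit_sphere) (inner C)" "openin (top_of_set unit_sphere) (outer C)"
    "connected (inner C)" "connected (outer C)" "inner C \<noteq> {}" "outer C \<noteq> {}"
    "closure (inner C) = inner C \<union> C" "closure (outer C) = outer C \<union> C"
proof -
  have hg: "simple_path (h \<circ> g)" "path_image (h \<circ> g) = h ` C"
    using simple_path_h[OF g(1)] C by auto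
  have loop: "pathfinish (h \<circ> g) = pathstart (h \<circ> g)"
    using g(2) by (simp add: pathfinish_compose pathstart_compose)
  note J = Jordan_inside_outside[OF hg(1) loop, unfolded hg(2)]
  have kC: "k ` h ` C = C" using C k_image_h by blast
  have kU: "range k = unit_sphere - {q}" using hk by (auto simp: homeomorphism_def)
  have "inside (h ` C) \<union> outside (h ` C) \<union> h ` C = UNIV" using J by blast
  then have "k ` inside (h ` C) \<union> k ` outside (h ` C) \<union> C = unit_sphere - {q}"
    using kC kU by (metis image_Un)
  moreover have "k ` inside (h ` C) \<inter> C = {}" "k ` outside (h ` C) \<inter> C = {}" 
    "k ` inside (h ` C) \<inter> k ` outside (h ` C) = {}"
    using J kC image_Int[OF inj_k] by (metis Diff_disjoint inside_no_overlap inside_outside image_is_empty 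
      inf_commute outside_no_overlap inside_Int_outside)+
  moreover have "q \<notin> k ` X" for X using k_in by auto
  ultimately show un: "inner C \<union> outer C = unit_sphere - C" and dj: "inner C \<inter> outer C = {}"
    unfolding inner_def outer_def using C q by blast+
  have cK: "compact (C \<union> inner C)"
  proof -
    have "closure (inside (h ` C)) = h ` C \<union> inside (h ` C)" 
      using J by (metis Un_commute closure_Un_frontier)
    then have "C \<union> inner C = k ` closure (inside (h ` C))" unfolding inner_def by (simp add: image_Un kC)
    moreover have "compact (closure (inside (h ` C)))" using J by (simp add: compact_closure)
    ultimately show ?thesis using continuous_on_subset[OF continuous_k] compact_continuous_image by (metis subset_UNIV)
  qed
  show oi: "openin (top_of_set unit_sphere) (inner C)" unfolding inner_def using J by (intro openin_k_image) auto
  show oo: "openin (top_of_set unit_sphere) (outer C)"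
  proof -
    \<comment> \<open>Openness at \<open>q\<close> is invisible in the chart, so
      \<open>outer C\<close> is written as the complement of a compact set.\<close>
    have "outer C = unit_sphere - (C \<union> inner C)" using un dj C by blast
    moreover have "openin (top_of_set unit_sphere) (unit_sphere - (C \<union> inner C))"
      using cK by (intro openin_minus_closed compact_imp_closed) auto
    ultimately show ?thesis by simp
  qed
  have ck: "connected (k ` X)" if "connected X" for X 
    by (rule connected_continuous_image[OF continuous_on_subset[OF continuous_k] that]) simp
  then show "connected (inner C)" unfolding inner_def using J by blast
  \<comment> \<open>The outside is unbounded and hence accumulates at the puncture, so adding
    \<open>q\<close> keeps it connected.\<close>
  have qc: "q \<in> closure (k ` outside (h ` C))" using J by (intro puncture_in_closure) auto
  show "connected (outer C)"
    unfolding outer_def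
  proof (rule connected_intermediate_closure)
    show "connected (k ` outside (h ` C))" using J by (intro ck) auto
  qed (use qc closure_subset[of "k ` outside (h ` C)"] in blast)+
  show "inner C \<noteq> {}" "outer C \<noteq> {}" using J by (auto simp: inner_def outer_def)
  have sub: "inner C \<subseteq> unit_sphere" "outer C \<subseteq> unit_sphere" using oi oo openin_imp_subset by blast+
  have cl: "closure X \<subseteq> unit_sphere" if "X \<subseteq> unit_sphere" for X 
    using that by (intro closure_minimal) auto
  have "C \<subseteq> closure (inner C)"
  proof -
    have "h ` C \<subseteq> closure (inside (h ` C))" using J by (metis Un_upper2 closure_Un_frontier)
    then have "k ` h ` C \<subseteq> closure (k ` inside (h ` C))" using k_closure_subset by blast
    then show ?thesis by (simp add: kC inner_def)
  qed
  moreover have "closure (inner C) \<inter> outer C = {}"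
    using openin_Int_closure_empty[OF oo sub(1)] dj by blast
  ultimately show "closure (inner C) = inner C \<union> C"
    using un cl[OF sub(1)] closure_subset[of "inner C"] C by blast
  have "C \<subseteq> closure (outer C)"
  proof -
    have "h ` C \<subseteq> closure (outside (h ` C))" using J by (metis Un_upper2 closure_Un_frontier)
    then have "k ` h ` C \<subseteq> closure (k ` outside (h ` C))" using k_closure_subset by blast
    also have "\<dots> \<subseteq> closure (outer C)" unfolding outer_def by (intro closure_mono) auto
    finally show ?thesis by (simp add: kC)
  qed
  moreover have "closure (outer C) \<inter> inner C = {}"
    using openin_Int_closure_empty[OF oi sub(2)] dj by blast
  ultimately show "closure (outer C) = outer C \<union> C"
    using un cl[OF sub(2)] closure_subset[of "outer C"] C by blast
qed

end

lemma sphere_chart: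
  assumes "q \<in> unit_sphere"
  obtains h k where "planar_chart q h k"
  using punctured_unit_sphere_plane[OF assms] assms by (metis planar_chart.intro)

text \<open>\<open>F\<close> avoids \<open>C\<close> and so lies in one side by connectedness; its
  frontier does not meet that side, so it is clopen there. This recognises a face from its frontier
  alone.\<close>

lemma side_eq:
  assumes D: "D1 \<union> D2 = S - C" "D1 \<inter> D2 = {}" "openin (top_of_set S) D1" "openin (top_of_set S) D2"
      "connected D1" "connected D2"
    and F: "connected F" "openin (top_of_set S) F" "F \<noteq> {}" "closure F - F = C"
  shows "F = D1 \<or> F = D2"
proof -
  have "F \<subseteq> D1 \<union> D2" using F(4) openin_imp_subset[OF F(2)] D(1) by blast
  then have "F \<subseteq> D1 \<or> F \<subseteq> D2" using connected_subset_either[OF F(1) D(3,4,2)] by blast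
  moreover have "F = D" if "D \<in> {D1, D2}" "F \<subseteq> D" for D
  proof (rule clopen_eq[OF _ F(2,3) that(2)])
    show "connected D" "D \<subseteq> S" using that D by auto
    have "D \<inter> C = {}" using that D(1) by auto
    then show "closure F \<inter> D \<subseteq> F" using F(4) by blast
  qed
  ultimately show ?thesis by auto
qed

text \<open>In a planar chart, \<open>U\<close> would be an open set injected continuously into the line, against
  invariance of dimension.\<close>

lemma embedded_line_no_openin:
  fixes f :: "real^3 \<Rightarrow> real"
  assumes U: "openin (top_of_set unit_sphere) U" "U \<subseteq> K" 
    and f: "continuous_on K f" "inj_on f K"
  shows "U = {}"
proof (rule ccontr)
  assume "U \<noteq> {}"
  then obtain y where y: "y \<in> U" by auto
  then have yS: "y \<in> unit_sphere" using U openin_imp_subset by blast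
  have "y \<noteq> - y"
  proof
    assume "y = - y"
    then have "y + y = 0" by (metis add.right_inverse)
    then have "(2::real) *\<^sub>R y = 0" by (simp add: scaleR_2)
    then show False using yS by simp
  qed
  \<comment> \<open>Puncturing at the antipode keeps \<open>y\<close> in the domain of the
    chart.\<close>
  then have yq: "- y \<in> unit_sphere" "- y \<noteq> y" using yS by auto
  obtain h k where "planar_chart (- y) h k" using sphere_chart[OF yq(1)] .
  then interpret planar_chart "- y" h k .
  let ?U = "U - {- y}"
  have "openin (top_of_set unit_sphere) ?U" 
    using U(1) by (intro openin_minus_closed) auto
  then have o: "open (h ` ?U)" by (intro open_h_image) auto
  have sub: "?U \<subseteq> unit_sphere - {- y}" using U openin_imp_subset by blast
  have "k ` h ` ?U = ?U" using k_image_h[OF sub] .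
  then have kK: "k ` h ` ?U \<subseteq> K" using U(2) by auto
  have "continuous_on (h ` ?U) (f \<circ> k)"
    by (rule continuous_on_compose[OF continuous_on_subset[OF continuous_k] continuous_on_subset[OF f(1) kK]]) simp
  moreover have "inj_on (f \<circ> k) (h ` ?U)"
    by (rule comp_inj_on[OF inj_on_subset[OF inj_k] inj_on_subset[OF f(2) kK]]) simp
  ultimately have "DIM(complex) \<le> DIM(real)"
    using y yq(2) o by (intro invariance_of_dimension[of "h ` ?U" "f \<circ> k"]) auto
  then show False by simp
qed

text \<open>A finite form of the Baire property: removing one closed \<open>K\<close> from
  \<open>U\<close> leaves an open set covered by the others.\<close>

lemma openin_subset_Union_empty:
  assumes "finite \<K>" "\<And>K. K \<in> \<K> \<Longrightarrow> closed K"
    and K: "\<And>K U. K \<in> \<K> \<Longrightarrow> openin (top_of_set S) U \<Longrightarrow> U \<subseteq> K \<Longrightarrow> U = {}"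
    and U: "openin (top_of_set S) U" "U \<subseteq> \<Union>\<K>"
  shows "U = {}"
proof -
  have "finite \<L> \<Longrightarrow> \<L> \<subseteq> \<K> \<Longrightarrow> \<forall>U. openin (top_of_set S) U \<longrightarrow> U \<subseteq> \<Union>\<L> \<longrightarrow> U = {}" for \<L>
  proof (induction \<L> rule: finite_induct)
    case (insert K \<L>)
    have "U = {}" if U: "openin (top_of_set S) U" "U \<subseteq> \<Union>(insert K \<L>)" for U
    proof -
      have "openin (top_of_set S) (U - K)"
        using assms(2) insert.prems U(1) by (intro openin_minus_closed) auto
      moreover have "U - K \<subseteq> \<Union>\<L>" using U(2) by auto
      ultimately have "U - K = {}" using insert by blast
      then show ?thesis using K[of K U] insert.prems U(1) by auto
    qed
    then show ?case by blast
  qed simp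
  from this[OF assms(1) order_refl] show ?thesis using U by simp
qed

text \<open>With the puncture in \<open>F3\<close>, the chord \<open>d1\<close> splits the inside of \<open>c \<union> d3\<close>, cutting \<open>F2\<close> off from \<open>c\<close>.\<close>

lemma arc_not_on_three_faces:
  assumes arc: "arc c" "arc d1" "arc d2" "arc d3"
    and sub: "path_image c \<subseteq> unit_sphere" "path_image d1 \<subseteq> unit_sphere" 
      "path_image d2 \<subseteq> unit_sphere" "path_image d3 \<subseteq> unit_sphere"
    and ends: "pathstart c = u" "pathfinish c = v" "pathstart d1 = u" "pathfinish d1 = v"
      "pathstart d2 = u" "pathfinish d2 = v" "pathstart d3 = u" "pathfinish d3 = v"
    and int: "path_image c \<inter> path_image d1 = {u, v}" "path_image c \<inter> path_image d2 = {u, v}"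
      "path_image c \<inter> path_image d3 = {u, v}" "path_image d1 \<inter> path_image d2 = {u, v}"
      "path_image d1 \<inter> path_image d3 = {u, v}"
    and F: "connected F1" "openin (top_of_set unit_sphere) F1" "F1 \<noteq> {}" "closure F1 - F1 = path_image c \<union> path_image d1"
      "connected F2" "openin (top_of_set unit_sphere) F2" "F2 \<noteq> {}" "closure F2 - F2 = path_image c \<union> path_image d2"
      "connected F3" "openin (top_of_set unit_sphere) F3" "F3 \<noteq> {}" "closure F3 - F3 = path_image c \<union> path_image d3"
    and dj: "F1 \<inter> F2 = {}" "F1 \<inter> F3 = {}" "F2 \<inter> F3 = {}"
    and off: "(F1 \<union> F2 \<union> F3) \<inter> (path_image c \<union> path_image d1 \<union> path_image d2 \<union> path_image d3) = {}"
  shows False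
proof -
  \<comment> \<open>This choice makes \<open>F3\<close> the outer side of its curve, and
    \<open>F1\<close> and \<open>F2\<close> the inner sides of theirs.\<close>
  obtain q where qF: "q \<in> F3" using F(11) by auto
  then have "q \<in> unit_sphere" using F(10) openin_imp_subset by blast
  then obtain h k where "planar_chart q h k" using sphere_chart by blast
  then interpret planar_chart q h k .
  have qn: "q \<notin> F1" "q \<notin> F2" "q \<notin> path_image c" "q \<notin> path_image d1" "q \<notin> path_image d2" "q \<notin> path_image d3"
    using qF dj off by auto
  have loop: "simple_path (r +++ reversepath s)" "pathfinish (r +++ reversepath s) = pathstart (r +++ reversepath s)"
      "path_image (r +++ reversepath s) = path_image r \<union> path_image s"
    if "arc r" "arc s" "pathstart r = u" "pathfinish r = v" "pathstart s = u" "pathfinish s = v"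
      "path_image r \<inter> path_image s = {u, v}" for r s
  proof -
    show "simple_path (r +++ reversepath s)" 
      using that by (intro simple_path_join_loop) (auto simp: arc_reversepath)
  qed (use that in \<open>auto simp: path_image_join\<close>)
  have S: "path_image c \<union> path_image d1 \<subseteq> unit_sphere - {q}" "path_image c \<union> path_image d2 \<subseteq> unit_sphere - {q}"
    "path_image c \<union> path_image d3 \<subseteq> unit_sphere - {q}" "path_image d3 \<union> path_image d1 \<subseteq> unit_sphere - {q}"
    using sub qn by auto
  have int31: "path_image d3 \<inter> path_image d1 = {u, v}" using int(5) by blast
  note J1 = Jordan_sphere[OF loop[OF arc(1,2) ends(1,2,3,4) int(1)] S(1)]
  note J2 = Jordan_sphere[OF loop[OF arc(1,3) ends(1,2,5,6) int(2)] S(2)]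
  note J3 = Jordan_sphere[OF loop[OF arc(1,4) ends(1,2,7,8) int(3)] S(3)]
  note J4 = Jordan_sphere[OF loop[OF arc(4,2) ends(7,8,3,4) int31] S(4)]
  have qo: "q \<in> outer C" for C by (simp add: outer_def)
  have F1: "F1 = inner (path_image c \<union> path_image d1)"
    using side_eq[OF J1(1-6) F(1-4)] qo qn by blast
  have F2: "F2 = inner (path_image c \<union> path_image d2)"
    using side_eq[OF J2(1-6) F(5-8)] qo qn by blast
  have F3: "F3 = outer (path_image c \<union> path_image d3)"
    using side_eq[OF J3(1-6) F(9-12)] qo qF J3(2) by blast
  have sp: "simple_path c" "simple_path d1" "simple_path d3" using arc arc_imp_simple_path by auto
  have S': "path_image c \<subseteq> unit_sphere - {q}" "path_image d1 \<subseteq> unit_sphere - {q}" "path_image d3 \<subseteq> unit_sphere - {q}"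
    using S by auto
  note hp = simple_path_h[OF sp(1) S'(1)] simple_path_h[OF sp(2) S'(2)] simple_path_h[OF sp(3) S'(3)]
  have uv: "u \<in> unit_sphere - {q}" "v \<in> unit_sphere - {q}" "u \<noteq> v"
    using S'(1) ends(1,2) arc_distinct_ends[OF arc(1)] pathstart_in_path_image[of c] pathfinish_in_path_image[of c] by auto
  have huv: "h u \<noteq> h v" using inj_onD[OF inj_h _ uv(1,2)] uv(3) by blast
  have him: "h ` X \<inter> h ` Y = {h u, h v}" if "X \<inter> Y = {u, v}" "X \<subseteq> unit_sphere - {q}" "Y \<subseteq> unit_sphere - {q}" for X Y
    using inj_on_image_Int[OF inj_h that(2,3)] that(1) by auto
  have he: "pathstart (h \<circ> d3) = h u" "pathfinish (h \<circ> d3) = h v" "pathstart (h \<circ> c) = h u" "pathfinish (h \<circ> c) = h v"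
    "pathstart (h \<circ> d1) = h u" "pathfinish (h \<circ> d1) = h v"
    using ends by (auto simp: pathstart_compose pathfinish_compose)
  obtain x where x: "x \<in> path_image d1" "x \<noteq> u" "x \<noteq> v"
    using nonempty_simple_path_endless[OF sp(2)] unfolding ends by blast
  \<comment> \<open>An interior point of \<open>d1\<close> is off the curve and off its outer side
    \<open>F3\<close>, so \<open>d1\<close> is a genuine chord of the inner side.\<close>
  have "x \<in> inner (path_image c \<union> path_image d3)"
  proof -
    have "x \<notin> F3" using off x(1) by blast
    moreover have "x \<notin> path_image c \<union> path_image d3" using int(1,5) x by blast
    ultimately show ?thesis using J3(1) F3 S'(2) x(1) by blast
  qed
  then have "h x \<in> inside (h ` path_image d3 \<union> h ` path_image c)"
    by (auto simp: inner_def image_Un Un_commute)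
  then have ne: "path_image (h \<circ> d1) \<inter> inside (path_image (h \<circ> d3) \<union> path_image (h \<circ> c)) \<noteq> {}"
    using x(1) unfolding hp(2,4,6) by blast
  have I: "inside (h ` path_image d3 \<union> h ` path_image d1) \<union> inside (h ` path_image c \<union> h ` path_image d1) \<union>
      (h ` path_image d1 - {h u, h v}) = inside (h ` path_image d3 \<union> h ` path_image c)"
    using split_inside_simple_closed_curve[OF hp(5) he(1,2) hp(1) he(3,4) hp(3) he(5,6) huv _ _ _ ne]
    unfolding hp(2,4,6)
    using him[OF _ S'(3,1)] him[OF _ S'(3,2)] him[OF _ S'(1,2)] int(1,3) int31 by (metis inf_commute)
  have in3: "inner (path_image d3 \<union> path_image d1) \<subseteq> inner (path_image c \<union> path_image d3)"
  proof -
    have "inside (h ` path_image d3 \<union> h ` path_image d1) \<subseteq> inside (h ` path_image d3 \<union> h ` path_image c)" using I by blast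
    then show ?thesis unfolding inner_def image_Un Un_commute[of "h ` path_image c"] by (rule image_mono)
  qed
  \<comment> \<open>\<open>F2\<close> lies inside \<open>c \<union> d3\<close> but meets neither the
    chord nor \<open>F1\<close>, which is one of the two parts cut off by the chord; the other part
    remains.\<close>
  have "F2 \<subseteq> inner (path_image d3 \<union> path_image d1)"
  proof
    fix y assume y: "y \<in> F2"
    have yS: "y \<in> unit_sphere" "y \<noteq> q" using y F(6) openin_imp_subset qn by blast+
    then have "y \<in> inner (path_image c \<union> path_image d3)" using J3(1) F3 dj(3) off y by blast
    then have "h y \<in> inside (h ` path_image d3 \<union> h ` path_image c)"
      by (auto simp: inner_def image_Un Un_commute)
    moreover have "h y \<notin> h ` path_image d1"
    proof
      assume "h y \<in> h ` path_image d1"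
      then obtain z where z: "z \<in> path_image d1" "h y = h z" by auto
      then have "y = z" using inj_onD[OF inj_h z(2)] yS S'(2) by blast
      then show False using off y z(1) by blast
    qed
    moreover have "h y \<notin> inside (h ` path_image c \<union> h ` path_image d1)"
    proof
      assume "h y \<in> inside (h ` path_image c \<union> h ` path_image d1)"
      then have "k (h y) \<in> F1" unfolding F1 inner_def image_Un by (rule imageI)
      then show False using k_h[OF yS] y dj(1) by auto
    qed
    ultimately have "h y \<in> inside (h ` path_image d3 \<union> h ` path_image d1)" using I by blast
    then have "k (h y) \<in> inner (path_image d3 \<union> path_image d1)" unfolding inner_def image_Un by (rule imageI)
    then show "y \<in> inner (path_image d3 \<union> path_image d1)" using k_h[OF yS] by simp
  qed
  then have cl: "closure F2 \<subseteq> inner (path_image d3 \<union> path_image d1) \<union> (path_image d3 \<union> path_image d1)"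
    using closure_mono J4(9) by metis
  \<comment> \<open>An interior point of \<open>c\<close> adheres to \<open>F2\<close>, yet the
    closure of the part containing \<open>F2\<close> reaches \<open>c\<close> only at the common
    ends.\<close>
  obtain z where z: "z \<in> path_image c" "z \<noteq> u" "z \<noteq> v"
    using nonempty_simple_path_endless[OF sp(1)] unfolding ends by blast
  have "z \<in> closure F2" using z F(8) by blast
  moreover have "z \<notin> path_image d3 \<union> path_image d1" using int(1,3) z by blast
  ultimately have "z \<in> inner (path_image c \<union> path_image d3)" using cl in3 by blast
  then show False using J3(1) z(1) by blast
qed

section \<open>Faces and face triangles of a triangulated sphere\<close>

locale sphere_triangulation =
  fixes V :: "'a set" and E p \<gamma>
  assumes triangulation: "simple_sphere_triangulation V E p \<gamma>"
begin

definition graph where "graph = p ` V \<union> (\<Union>e\<in>E. path_image (\<gamma> e))"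
definition faces where "faces = embedding_faces V E p \<gamma>"

lemma emb: "simple_graph V E" "sphere_embedding V E p \<gamma>"
  using triangulation by (auto simp: simple_sphere_triangulation_def)

lemma finite_V [simp]: "finite V"
  using emb(1) by (simp add: simple_graph_def)

lemma edge_subset: "e \<in> E \<Longrightarrow> e \<subseteq> V" and card_edge: "e \<in> E \<Longrightarrow> card e = 2"
  using emb(1) by (auto simp: simple_graph_def)

lemma finite_E [simp]: "finite E"
  using edge_subset by (intro finite_subset[of E "Pow V"]) auto

lemma inj_p: "inj_on p V" and p_in: "v \<in> V \<Longrightarrow> p v \<in> unit_sphere"
  using emb(2) unfolding sphere_embedding_def by blast+

lemma arc_\<gamma>: "e \<in> E \<Longrightarrow> arc (\<gamma> e)" and \<gamma>_in: "e \<in> E \<Longrightarrow> path_image (\<gamma> e) \<subseteq> unit_sphere"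
  and ends_\<gamma>: "e \<in> E \<Longrightarrow> {pathstart (\<gamma> e), pathfinish (\<gamma> e)} = p ` e"
  and \<gamma>_vertices: "e \<in> E \<Longrightarrow> path_image (\<gamma> e) \<inter> p ` V = p ` e"
  and \<gamma>_Int: "e \<in> E \<Longrightarrow> e' \<in> E \<Longrightarrow> e \<noteq> e' \<Longrightarrow> path_image (\<gamma> e) \<inter> path_image (\<gamma> e') = p ` (e \<inter> e')"
  using emb(2) unfolding sphere_embedding_def by blast+

lemma graph_subset: "graph \<subseteq> unit_sphere"
  using p_in \<gamma>_in by (auto simp: graph_def)

lemma closed_graph: "closed graph"
  unfolding graph_def using arc_\<gamma> 
  by (intro closed_Un closed_UN finite_imp_closed) (auto simp: closed_path_image arc_imp_path)

lemma openin_compl_graph: "openin (top_of_set unit_sphere) (unit_sphere - graph)"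
  by (intro openin_minus_closed closed_graph) auto

lemma face_props:
  assumes "F \<in> faces"
  shows "F \<noteq> {}" "connected F" "openin (top_of_set unit_sphere) F" "F \<subseteq> unit_sphere - graph"
proof -
  have F: "F \<in> components (unit_sphere - graph)" 
    using assms by (simp add: faces_def embedding_faces_def graph_def)
  then show "F \<noteq> {}" "connected F" "F \<subseteq> unit_sphere - graph"
    using in_components_nonempty in_components_connected in_components_subset by blast+
  have "locally connected (unit_sphere - graph)"
    using locally_open_subset[OF locally_connected_sphere openin_compl_graph] .
  then show "openin (top_of_set unit_sphere) F"
    using openin_components_locally_connected F openin_compl_graph openin_trans by blast
qed

lemma faces_disjoint: "F \<in> faces \<Longrightarrow> F' \<in> faces \<Longrightarrow> F \<noteq> F' \<Longrightarrow> F \<inter> F' = {}"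
  unfolding faces_def embedding_faces_def by (metis components_nonoverlap)

lemma Union_faces: "\<Union>faces = unit_sphere - graph"
  unfolding faces_def embedding_faces_def graph_def by (rule Union_components)

text \<open>Such a set is clopen in the component of the complement of the graph that contains it.
  This produces a face where no vertex lies on one side of a triangle.\<close>

lemma faceI:
  assumes D: "D \<noteq> {}" "connected D" "openin (top_of_set unit_sphere) D" "D \<subseteq> unit_sphere - graph"
    and cl: "closure D \<subseteq> D \<union> graph"
  shows "D \<in> faces"
proof -
  obtain x where "x \<in> D" using D(1) by auto
  then obtain F where F: "F \<in> faces" "x \<in> F" using Union_faces D(4) by blast
  have "F \<in> components (unit_sphere - graph)" 
    using F by (simp add: faces_def embedding_faces_def graph_def)
  then have "D \<subseteq> F" using components_maximal D(2,4) F(2) \<open>x \<in> D\<close> by blast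
  moreover have "F \<subseteq> unit_sphere" "closure D \<inter> F \<subseteq> D" using face_props(4)[OF F(1)] cl by auto
  ultimately have "D = F" using clopen_eq[OF face_props(2)[OF F(1)] D(3,1)] by blast
  then show ?thesis using F by simp
qed

lemma frontier_face:
  assumes "F \<in> faces"
  shows "top_of_set unit_sphere frontier_of F = closure F - F"
proof -
  have "F \<subseteq> unit_sphere" using face_props(4)[OF assms] by blast
  moreover from this have "closure F \<subseteq> unit_sphere" by (intro closure_minimal) auto
  moreover from calculation(1) have "unit_sphere \<inter> F = F" by blast
  ultimately show ?thesis 
    unfolding frontier_of_def interior_of_openin[OF face_props(3)[OF assms]]
    by (auto simp: closure_of_subtopology)
qed

definition clique where "clique t \<longleftrightarrow> t \<subseteq> V \<and> card t = 3 \<and> (\<forall>x\<in>t. \<forall>y\<in>t. x \<noteq> y \<longrightarrow> {x, y} \<in> E)"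
definition curve where "curve t = (\<Union>e\<in>{e\<in>E. e \<subseteq> t}. path_image (\<gamma> e))"
text \<open>The cliques that bound a face, recorded as vertex sets. The remaining cliques are the
  separating triangles.\<close>

definition triangles where "triangles = {t. clique t \<and> (\<exists>F\<in>faces. closure F - F = curve t)}"

lemma curve_eq:
  assumes "{a, b} \<in> E" "{b, c} \<in> E" "{a, c} \<in> E" "a \<noteq> b" "b \<noteq> c" "a \<noteq> c"
  shows "curve {a, b, c} = path_image (\<gamma> {a, b}) \<union> path_image (\<gamma> {b, c}) \<union> path_image (\<gamma> {a, c})"
proof -
  have "{e \<in> E. e \<subseteq> {a, b, c}} = {{a, b}, {b, c}, {a, c}}"
  proof (intro equalityI subsetI)
    fix e assume e: "e \<in> {e \<in> E. e \<subseteq> {a, b, c}}"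
    then have "card e = 2" using card_edge by blast
    then obtain x y where "e = {x, y}" "x \<noteq> y" by (auto simp: card_2_iff)
    then show "e \<in> {{a, b}, {b, c}, {a, c}}" using e by auto
  qed (use assms in auto)
  then show ?thesis by (auto simp: curve_def)
qed

lemma cliqueE:
  assumes "clique t"
  obtains a b c where "t = {a, b, c}" "a \<noteq> b" "b \<noteq> c" "a \<noteq> c" "{a, b} \<in> E" "{b, c} \<in> E" "{a, c} \<in> E"
proof -
  obtain a b c where abc: "t = {a, b, c}" "a \<noteq> b" "b \<noteq> c" "a \<noteq> c" using assms by (auto simp: clique_def card_3_iff)
  then show thesis using assms that[of a b c] by (auto simp: clique_def)
qed

lemma cliqueI:
  assumes "{a, b} \<in> E" "{b, c} \<in> E" "{a, c} \<in> E" "a \<noteq> b" "b \<noteq> c" "a \<noteq> c"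
  shows "clique {a, b, c}"
proof -
  have "{b, a} \<in> E" "{c, b} \<in> E" "{c, a} \<in> E" using assms by (simp_all add: insert_commute)
  moreover have "{a, b, c} \<subseteq> V" using edge_subset[OF assms(1)] edge_subset[OF assms(2)] by simp
  ultimately show ?thesis unfolding clique_def using assms by simp
qed

lemma face_triangle:
  assumes F: "F \<in> faces"
  shows "\<exists>t\<in>triangles. closure F - F = curve t"
proof -
  have "\<exists>a b c. a \<noteq> b \<and> b \<noteq> c \<and> a \<noteq> c \<and> {{a, b}, {b, c}, {a, c}} \<subseteq> E \<and>
    top_of_set unit_sphere frontier_of F =
          path_image (\<gamma> {a, b}) \<union> path_image (\<gamma> {b, c}) \<union> path_image (\<gamma> {a, c})"
    using triangulation F by (simp add: simple_sphere_triangulation_def faces_def)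
  then obtain a b c where abc: "a \<noteq> b" "b \<noteq> c" "a \<noteq> c" "{a, b} \<in> E" "{b, c} \<in> E" "{a, c} \<in> E"
    "top_of_set unit_sphere frontier_of F =
          path_image (\<gamma> {a, b}) \<union> path_image (\<gamma> {b, c}) \<union> path_image (\<gamma> {a, c})"
    by auto
  then have "closure F - F = curve {a, b, c}" using frontier_face[OF F] curve_eq[of a b c] by simp
  moreover have "clique {a, b, c}" using abc by (intro cliqueI)
  ultimately show ?thesis using F by (auto simp: triangles_def)
qed

lemma edge_arc:
  assumes "{a, b} \<in> E"
  obtains g where "arc g" "path_image g = path_image (\<gamma> {a, b})" "pathstart g = p a" "pathfinish g = p b"
proof -
  have "{pathstart (\<gamma> {a, b}), pathfinish (\<gamma> {a, b})} = {p a, p b}" using ends_\<gamma>[OF assms] by simp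
  then consider "pathstart (\<gamma> {a, b}) = p a" "pathfinish (\<gamma> {a, b}) = p b" 
    | "pathstart (\<gamma> {a, b}) = p b" "pathfinish (\<gamma> {a, b}) = p a" by (auto simp: doubleton_eq_iff)
  then show thesis
  proof cases
    case 1
    then show ?thesis using that[of "\<gamma> {a, b}"] arc_\<gamma>[OF assms] by auto
  next
    case 2
    then show ?thesis using that[of "reversepath (\<gamma> {a, b})"] arc_\<gamma>[OF assms] by (auto simp: arc_reversepath)
  qed
qed

text \<open>Supplies the detours around an edge through the third vertex of a triangle, and closes
  the loop along a clique.\<close>

lemma path2_arc:
  assumes "{a, c} \<in> E" "{c, b} \<in> E" "a \<noteq> b"
  obtains g where "arc g" "path_image g = path_image (\<gamma> {a, c}) \<union> path_image (\<gamma> {c, b})" 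
    "pathstart g = p a" "pathfinish g = p b"
proof -
  obtain g1 where g1: "arc g1" "path_image g1 = path_image (\<gamma> {a, c})" "pathstart g1 = p a" "pathfinish g1 = p c"
    using edge_arc[OF assms(1)] .
  obtain g2 where g2: "arc g2" "path_image g2 = path_image (\<gamma> {c, b})" "pathstart g2 = p c" "pathfinish g2 = p b"
    using edge_arc[OF assms(2)] .
  have ne: "a \<noteq> c" "c \<noteq> b" using card_edge[OF assms(1)] card_edge[OF assms(2)] by auto
  then have "{a, c} \<noteq> {c, b}" "{a, c} \<inter> {c, b} = {c}" using assms(3) by (auto simp: doubleton_eq_iff)
  then have "path_image g1 \<inter> path_image g2 = p ` {c}" using \<gamma>_Int[OF assms(1,2)] g1(2) g2(2) by metis
  then have "arc (g1 +++ g2)" using g1 g2 by (intro arc_join) auto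
  then show thesis using that[of "g1 +++ g2"] g1 g2 by (auto simp: path_image_join)
qed

lemma curve_vertices:
  assumes "clique t" shows "curve t \<inter> p ` V = p ` t"
proof -
  obtain a b c where abc: "t = {a, b, c}" "a \<noteq> b" "b \<noteq> c" "a \<noteq> c" "{a, b} \<in> E" "{b, c} \<in> E" "{a, c} \<in> E"
    using cliqueE[OF assms] .
  have "curve t \<inter> p ` V = p ` {a, b} \<union> p ` {b, c} \<union> p ` {a, c}"
    using \<gamma>_vertices abc unfolding abc(1) curve_eq[OF abc(5,6,7,2,3,4)] Int_Un_distrib2 by simp
  then show ?thesis using abc(1) by auto
qed

lemma curve_subset: "curve t \<subseteq> graph"
  by (auto simp: curve_def graph_def)

lemma clique_loop:
  assumes "clique t"
  obtains g where "simple_path g" "pathfinish g = pathstart g" "path_image g = curve t"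
proof -
  obtain a b c where abc: "t = {a, b, c}" "a \<noteq> b" "b \<noteq> c" "a \<noteq> c" "{a, b} \<in> E" "{b, c} \<in> E" "{a, c} \<in> E"
    using cliqueE[OF assms] .
  obtain g1 where g1: "arc g1" "path_image g1 = path_image (\<gamma> {a, c})" "pathstart g1 = p a" "pathfinish g1 = p c"
    using edge_arc[OF abc(7)] .
  have E: "{c, b} \<in> E" "{b, a} \<in> E" using abc(5,6) by (auto simp: insert_commute)
  obtain g2 where g2: "arc g2" "path_image g2 = path_image (\<gamma> {c, b}) \<union> path_image (\<gamma> {b, a})" 
    "pathstart g2 = p c" "pathfinish g2 = p a"
    using path2_arc[OF E] abc(4) by metis
  have "path_image (\<gamma> {a, c}) \<inter> path_image (\<gamma> {c, b}) = p ` ({a, c} \<inter> {c, b})"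
    "path_image (\<gamma> {a, c}) \<inter> path_image (\<gamma> {b, a}) = p ` ({a, c} \<inter> {b, a})"
    using abc(2-4) by (intro \<gamma>_Int abc E; force simp: doubleton_eq_iff)+
  then have "path_image g1 \<inter> path_image g2 \<subseteq> {p a, p c}" unfolding g1(2) g2(2) using abc(2-4) by auto
  then have "simple_path (g1 +++ g2)" using g1 g2 by (intro simple_path_join_loop) auto
  moreover have "path_image (g1 +++ g2) = curve t"
    unfolding abc(1) curve_eq[OF abc(5,6,7,2,3,4)] 
    using g1 g2 by (simp add: path_image_join insert_commute Un_commute Un_left_commute)
  ultimately show thesis using that[of "g1 +++ g2"] g1 g2 by simp
qed

text \<open>Every piece of the graph embeds in the line, a vertex by a constant map and an arc by
  the inverse of its parametrisation; finitely many such pieces cannot cover a nonempty open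
  set.\<close>

lemma openin_subset_graph:
  assumes "openin (top_of_set unit_sphere) U" "U \<subseteq> graph"
  shows "U = {}"
proof (rule openin_subset_Union_empty[of "(\<lambda>v. {p v}) ` V \<union> (\<lambda>e. path_image (\<gamma> e)) ` E"])
  fix K U assume K: "K \<in> (\<lambda>v. {p v}) ` V \<union> (\<lambda>e. path_image (\<gamma> e)) ` E" 
    and U: "openin (top_of_set unit_sphere) U" "U \<subseteq> K"
  show "U = {}"
  proof (cases "K \<in> (\<lambda>v. {p v}) ` V")
    case True
    then show ?thesis using embedded_line_no_openin[OF U, of "\<lambda>_. 0"] by auto
  next
    case False
    then obtain e where e: "e \<in> E" "K = path_image (\<gamma> e)" using K by auto
    obtain h where "homeomorphism {0..1} K (\<gamma> e) h" using homeomorphism_arc[OF arc_\<gamma>[OF e(1)]] e(2) by metis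
    then have "continuous_on K h" "inj_on h K" 
      by (auto simp: homeomorphism_def intro: inj_on_inverseI[where g = "\<gamma> e"])
    then show ?thesis using embedded_line_no_openin[OF U] by blast
  qed
qed (use assms arc_\<gamma> in \<open>auto simp: graph_def closed_path_image arc_imp_path\<close>)

lemma sides:
  assumes t: "clique t"
  obtains D1 D2 where "D1 \<union> D2 = unit_sphere - curve t" "D1 \<inter> D2 = {}"
    "openin (top_of_set unit_sphere) D1" "openin (top_of_set unit_sphere) D2"
    "connected D1" "connected D2" "D1 \<noteq> {}" "D2 \<noteq> {}"
    "closure D1 = D1 \<union> curve t" "closure D2 = D2 \<union> curve t"
proof -
  have "unit_sphere \<noteq> ({} :: (real^3) set)" by simp
  then have "\<not> unit_sphere \<subseteq> graph" using openin_subset_graph[of unit_sphere] by auto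
  then obtain q where q_off: "q \<in> unit_sphere" "q \<notin> graph" by blast
  obtain h k where "planar_chart q h k" using sphere_chart[OF q_off(1)] .
  then interpret planar_chart q h k .
  obtain g where g: "simple_path g" "pathfinish g = pathstart g" "path_image g = curve t" using clique_loop[OF t] .
  have "curve t \<subseteq> unit_sphere - {q}" using curve_subset graph_subset q_off(2) by blast
  from Jordan_sphere[OF g this] show thesis using that by blast
qed

text \<open>Every face is one of the two sides of one of finitely many cliques.\<close>

lemma finite_faces: "finite faces"
proof -
  have "finite {F \<in> faces. closure F - F = curve t}" if t: "clique t" for t
  proof -
    obtain D1 D2 where D: "D1 \<union> D2 = unit_sphere - curve t" "D1 \<inter> D2 = {}"
      "openin (top_of_set unit_sphere) D1" "openin (top_of_set unit_sphere) D2"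
      "connected D1" "connected D2" using sides[OF t] by metis
    have "{F \<in> faces. closure F - F = curve t} \<subseteq> {D1, D2}"
      using side_eq[OF D] face_props by blast
    then show ?thesis by (rule finite_subset) simp
  qed
  then have "finite (\<Union>t\<in>{t. clique t}. {F \<in> faces. closure F - F = curve t})"
    by (intro finite_UN_I) (auto simp: clique_def intro: finite_subset[of _ "Pow V"])
  moreover have "faces \<subseteq> (\<Union>t\<in>{t. clique t}. {F \<in> faces. closure F - F = curve t})"
    using face_triangle by (fastforce simp: triangles_def)
  ultimately show ?thesis by (rule rev_finite_subset)
qed

text \<open>The closures of the finitely many faces that meet \<open>D\<close> form a closed set. If
  it missed \<open>x\<close>, a nonempty open part of \<open>D\<close> would remain, and this would
  have to lie in the graph.\<close>

lemma adherent_face: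
  assumes D: "openin (top_of_set unit_sphere) D" and x: "x \<in> closure D"
  shows "\<exists>F\<in>faces. F \<inter> D \<noteq> {} \<and> x \<in> closure F"
proof (rule ccontr)
  assume "\<not> ?thesis"
  then have none: "x \<notin> closure F" if "F \<in> faces" "F \<inter> D \<noteq> {}" for F using that by blast
  let ?K = "\<Union>(closure ` {F \<in> faces. F \<inter> D \<noteq> {}})"
  have K: "closed ?K" using finite_faces by (intro closed_Union) auto
  have "D - ?K \<noteq> {}"
  proof
    assume "D - ?K = {}"
    then have "closure D \<subseteq> ?K" using K by (intro closure_minimal) auto
    then show False using x none by blast
  qed
  moreover have "openin (top_of_set unit_sphere) (D - ?K)" using D K by (rule openin_minus_closed)
  ultimately have "\<not> D - ?K \<subseteq> graph" using openin_subset_graph by blast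
  then obtain y where y: "y \<in> D" "y \<notin> ?K" "y \<notin> graph" by blast
  then have "y \<in> unit_sphere - graph" using openin_imp_subset[OF D] by blast
  then obtain F where F: "F \<in> faces" "y \<in> F" using Union_faces by blast
  then have "y \<in> ?K" using y(1) closure_subset[of F] by blast
  then show False using y(2) by simp
qed

text \<open>Different edges meet only in vertices, so an interior point determines its edge.\<close>

lemma curve_interior_edge:
  assumes e: "e \<in> E" and x: "x \<in> path_image (\<gamma> e)" "x \<notin> p ` e" "x \<in> curve t"
  shows "e \<subseteq> t"
proof -
  obtain e' where e': "e' \<in> E" "e' \<subseteq> t" "x \<in> path_image (\<gamma> e')" using x(3) by (auto simp: curve_def)
  have "e = e'"
  proof (rule ccontr)
    assume "e \<noteq> e'"
    then have "x \<in> p ` (e \<inter> e')" using \<gamma>_Int[OF e e'(1)] x(1) e'(3) by blast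
    then show False using x(2) by auto
  qed
  then show ?thesis using e'(2) by simp
qed

lemma curve_inj:
  assumes "clique t" "clique t'" "curve t = curve t'"
  shows "t = t'"
proof -
  have "p ` t = p ` t'" using curve_vertices assms by metis
  then show ?thesis using inj_on_image_eq_iff[OF inj_p] assms by (auto simp: clique_def)
qed

lemma open_edge:
  assumes e: "e \<in> E"
  shows "connected (path_image (\<gamma> e) - p ` e)" "path_image (\<gamma> e) - p ` e \<noteq> {}"
proof -
  have "simple_path (\<gamma> e)" using arc_imp_simple_path[OF arc_\<gamma>[OF e]] .
  then show "connected (path_image (\<gamma> e) - p ` e)" "path_image (\<gamma> e) - p ` e \<noteq> {}"
    using connected_simple_path_endless nonempty_simple_path_endless unfolding ends_\<gamma>[OF e, symmetric] by blast+
qed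

text \<open>Some face adheres to an interior point of \<open>e\<close>, and it is a full side of its
  triangle. The opposite side adheres there too, which yields a second face at \<open>e\<close>. If
  both faces had the same triangle, they would fill both sides and leave no place for a fourth
  vertex.\<close>

lemma edge_in_two_triangles:
  assumes V: "card V > 3" and e: "e \<in> E"
  shows "\<exists>t\<in>triangles. \<exists>t'\<in>triangles. t \<noteq> t' \<and> e \<subseteq> t \<and> e \<subseteq> t'"
proof -
  obtain x where x: "x \<in> path_image (\<gamma> e)" "x \<notin> p ` e" using open_edge(2)[OF e] by blast
  have xg: "x \<in> graph" using x(1) e by (auto simp: graph_def)
  have tri: "\<exists>t\<in>triangles. closure F - F = curve t \<and> e \<subseteq> t" if F: "F \<in> faces" "x \<in> closure F" for F
  proof -
    obtain t where t: "t \<in> triangles" "closure F - F = curve t" using face_triangle[OF F(1)] by blast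
    have "x \<notin> F" using xg face_props(4)[OF F(1)] by blast
    then have "x \<in> curve t" using F(2) t(2) by blast
    then show ?thesis using curve_interior_edge[OF e x] t by blast
  qed
  have "x \<in> closure unit_sphere" using xg graph_subset closure_subset by blast
  then obtain F1 where F1: "F1 \<in> faces" "x \<in> closure F1" using adherent_face[of unit_sphere x] by auto
  obtain t1 where t1: "t1 \<in> triangles" "closure F1 - F1 = curve t1" "e \<subseteq> t1" using tri[OF F1] by blast
  have cl1: "clique t1" using t1(1) by (simp add: triangles_def)
  obtain D1 D2 where D: "D1 \<union> D2 = unit_sphere - curve t1" "D1 \<inter> D2 = {}"
    "openin (top_of_set unit_sphere) D1" "openin (top_of_set unit_sphere) D2"
    "connected D1" "connected D2" "D1 \<noteq> {}" "D2 \<noteq> {}"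
    "closure D1 = D1 \<union> curve t1" "closure D2 = D2 \<union> curve t1" using sides[OF cl1] .
  have side: "F = D1 \<or> F = D2" if "F \<in> faces" "closure F - F = curve t1" for F
    using side_eq[OF D(1-6)] face_props[OF that(1)] that(2) by blast
  have "x \<in> curve t1" using t1(2) F1(2) xg face_props(4)[OF F1(1)] by blast
  then have "\<exists>D. openin (top_of_set unit_sphere) D \<and> x \<in> closure D \<and> F1 \<inter> D = {} \<and> F1 \<union> D = unit_sphere - curve t1
    \<and> (\<forall>F\<in>faces. closure F - F = curve t1 \<longrightarrow> F = F1 \<or> F = D)"
    using side[OF F1(1) t1(2)] D side by (metis Int_commute Un_commute Un_iff)
  then obtain D where D': "openin (top_of_set unit_sphere) D" "x \<in> closure D" "F1 \<inter> D = {}" 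
    "F1 \<union> D = unit_sphere - curve t1" "\<forall>F\<in>faces. closure F - F = curve t1 \<longrightarrow> F = F1 \<or> F = D" by blast
  obtain F2 where F2: "F2 \<in> faces" "F2 \<inter> D \<noteq> {}" "x \<in> closure F2" using adherent_face[OF D'(1,2)] by blast
  obtain t2 where t2: "t2 \<in> triangles" "closure F2 - F2 = curve t2" "e \<subseteq> t2" using tri[OF F2(1,3)] by blast
  have "t1 \<noteq> t2"
  proof
    assume "t1 = t2"
    then have "F2 = D" using D'(3,5) F2(1,2) t2(2) by blast
    then have "unit_sphere - curve t1 \<subseteq> unit_sphere - graph" 
      using D'(4) face_props(4)[OF F1(1)] face_props(4)[OF F2(1)] by blast
    then have "p ` V \<subseteq> curve t1" using graph_subset by (auto simp: graph_def)
    then have "p ` V = p ` t1" using curve_vertices[OF cl1] by blast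
    moreover have t1V: "t1 \<subseteq> V" "card t1 = 3" using cl1 by (simp_all add: clique_def)
    ultimately have "V = t1" using inj_on_image_eq_iff[OF inj_p] by blast
    then show False using V t1V(2) by simp
  qed
  then show ?thesis using t1 t2 by blast
qed

lemma vertex_in_triangle:
  assumes v: "v \<in> V"
  shows "\<exists>t\<in>triangles. v \<in> t"
proof -
  have "p v \<in> closure unit_sphere" using p_in[OF v] closure_subset by blast
  then obtain F where F: "F \<in> faces" "p v \<in> closure F" using adherent_face[of unit_sphere "p v"] by auto
  obtain t where t: "t \<in> triangles" "closure F - F = curve t" using face_triangle[OF F(1)] by blast
  have "p v \<notin> F" using v face_props(4)[OF F(1)] by (auto simp: graph_def)
  then have "p v \<in> p ` t" using F(2) t v curve_vertices[of t] by (auto simp: triangles_def)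
  moreover have "t \<subseteq> V" using t(1) by (simp add: triangles_def clique_def)
  ultimately have "v \<in> t" using inj_on_image_mem_iff[OF inj_p v] by blast
  then show ?thesis using t(1) by blast
qed

text \<open>The edge is the arc \<open>c\<close>, and the detours through \<open>w1\<close>,
  \<open>w2\<close>, \<open>w3\<close> are the arcs \<open>d1\<close>, \<open>d2\<close>,
  \<open>d3\<close> of the four-arc lemma.\<close>

lemma edge_not_in_three_triangles:
  assumes t: "{u, v, w1} \<in> triangles" "{u, v, w2} \<in> triangles" "{u, v, w3} \<in> triangles"
    and ne: "u \<noteq> v" "w1 \<noteq> w2" "w1 \<noteq> w3" "w2 \<noteq> w3"
  shows False
proof -
  have path: "\<exists>d F. arc d \<and> pathstart d = p u \<and> pathfinish d = p v \<and> 
      path_image d = path_image (\<gamma> {u, w}) \<union> path_image (\<gamma> {w, v}) \<and>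
      F \<in> faces \<and> closure F - F = path_image (\<gamma> {u, v}) \<union> path_image d \<and> closure F - F = curve {u, v, w} \<and>
      clique {u, v, w} \<and> {u, v} \<in> E \<and> {u, w} \<in> E \<and> {w, v} \<in> E \<and> w \<noteq> u \<and> w \<noteq> v"
    if w: "{u, v, w} \<in> triangles" for w
  proof -
    have cl: "clique {u, v, w}" using w by (simp add: triangles_def)
    then have "card {u, v, w} = 3" by (simp add: clique_def)
    then have d: "w \<noteq> u" "w \<noteq> v" by (auto simp: card_insert_if split: if_splits)
    have E: "{u, v} \<in> E" "{u, w} \<in> E" "{w, v} \<in> E" "{v, w} \<in> E" using cl d ne(1) by (auto simp: clique_def)
    obtain F where F: "F \<in> faces" "closure F - F = curve {u, v, w}" using w by (auto simp: triangles_def)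
    obtain d where "arc d" "path_image d = path_image (\<gamma> {u, w}) \<union> path_image (\<gamma> {w, v})" 
      "pathstart d = p u" "pathfinish d = p v" using path2_arc[OF E(2,3) ne(1)] .
    moreover have "curve {u, v, w} = path_image (\<gamma> {u, v}) \<union> path_image (\<gamma> {v, w}) \<union> path_image (\<gamma> {u, w})"
      using E d ne(1) by (intro curve_eq) auto
    ultimately show ?thesis using F E d cl by (intro exI[of _ d] exI[of _ F]) (auto simp: insert_commute)
  qed
  obtain d1 F1 where 1: "arc d1" "pathstart d1 = p u" "pathfinish d1 = p v"
      "path_image d1 = path_image (\<gamma> {u, w1}) \<union> path_image (\<gamma> {w1, v})" "F1 \<in> faces" 
      "closure F1 - F1 = path_image (\<gamma> {u, v}) \<union> path_image d1" "closure F1 - F1 = curve {u, v, w1}"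
      "clique {u, v, w1}" "{u, v} \<in> E" "{u, w1} \<in> E" "{w1, v} \<in> E" "w1 \<noteq> u" "w1 \<noteq> v" 
    using path[OF t(1)] by blast
  obtain d2 F2 where 2: "arc d2" "pathstart d2 = p u" "pathfinish d2 = p v"
      "path_image d2 = path_image (\<gamma> {u, w2}) \<union> path_image (\<gamma> {w2, v})" "F2 \<in> faces" 
      "closure F2 - F2 = path_image (\<gamma> {u, v}) \<union> path_image d2" "closure F2 - F2 = curve {u, v, w2}"
      "clique {u, v, w2}" "{u, v} \<in> E" "{u, w2} \<in> E" "{w2, v} \<in> E" "w2 \<noteq> u" "w2 \<noteq> v" 
    using path[OF t(2)] by blast
  obtain d3 F3 where 3: "arc d3" "pathstart d3 = p u" "pathfinish d3 = p v"
      "path_image d3 = path_image (\<gamma> {u, w3}) \<union> path_image (\<gamma> {w3, v})" "F3 \<in> faces" 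
      "closure F3 - F3 = path_image (\<gamma> {u, v}) \<union> path_image d3" "closure F3 - F3 = curve {u, v, w3}"
      "clique {u, v, w3}" "{u, v} \<in> E" "{u, w3} \<in> E" "{w3, v} \<in> E" "w3 \<noteq> u" "w3 \<noteq> v" 
    using path[OF t(3)] by blast
  obtain c where c: "arc c" "path_image c = path_image (\<gamma> {u, v})" "pathstart c = p u" "pathfinish c = p v"
    using edge_arc[OF 1(9)] .
  have chord: "path_image (\<gamma> {u, v}) \<inter> (path_image (\<gamma> {u, w}) \<union> path_image (\<gamma> {w, v})) = {p u, p v}"
    if "{u, w} \<in> E" "{w, v} \<in> E" "w \<noteq> u" "w \<noteq> v" for w
  proof -
    have "path_image (\<gamma> {u, v}) \<inter> path_image (\<gamma> {u, w}) = p ` ({u, v} \<inter> {u, w})"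
      "path_image (\<gamma> {u, v}) \<inter> path_image (\<gamma> {w, v}) = p ` ({u, v} \<inter> {w, v})"
      using that ne(1) by (intro \<gamma>_Int 1; force simp: doubleton_eq_iff)+
    then show ?thesis using that ne(1) by (auto simp: Int_Un_distrib)
  qed
  have detour: "(path_image (\<gamma> {u, w}) \<union> path_image (\<gamma> {w, v})) \<inter> (path_image (\<gamma> {u, w'}) \<union> path_image (\<gamma> {w', v})) = {p u, p v}"
    if "{u, w} \<in> E" "{w, v} \<in> E" "w \<noteq> u" "w \<noteq> v" "{u, w'} \<in> E" "{w', v} \<in> E" "w' \<noteq> u" "w' \<noteq> v" "w \<noteq> w'" for w w'
  proof -
    have "path_image (\<gamma> {u, w}) \<inter> path_image (\<gamma> {u, w'}) = p ` ({u, w} \<inter> {u, w'})"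
      "path_image (\<gamma> {u, w}) \<inter> path_image (\<gamma> {w', v}) = p ` ({u, w} \<inter> {w', v})"
      "path_image (\<gamma> {w, v}) \<inter> path_image (\<gamma> {u, w'}) = p ` ({w, v} \<inter> {u, w'})"
      "path_image (\<gamma> {w, v}) \<inter> path_image (\<gamma> {w', v}) = p ` ({w, v} \<inter> {w', v})"
      using that ne(1) by (intro \<gamma>_Int; force simp: doubleton_eq_iff)+
    moreover have "{u, w} \<inter> {u, w'} = {u}" "{u, w} \<inter> {w', v} = {}" "{w, v} \<inter> {u, w'} = {}" "{w, v} \<inter> {w', v} = {v}"
      using that ne(1) by auto
    ultimately show ?thesis by (simp add: Int_Un_distrib Int_Un_distrib2 insert_commute)
  qed
  have Fne: "F \<inter> F' = {}" if "F \<in> faces" "F' \<in> faces" "closure F - F = curve {u, v, w}" 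
    "closure F' - F' = curve {u, v, w'}" "clique {u, v, w}" "clique {u, v, w'}" "w \<noteq> w'" "w \<noteq> u" "w \<noteq> v" for F F' w w'
  proof -
    have "F \<noteq> F'"
    proof
      assume "F = F'"
      then have "{u, v, w} = {u, v, w'}" using that curve_inj by metis
      then show False using that by auto
    qed
    then show ?thesis using faces_disjoint that by blast
  qed
  note fp1 = face_props[OF 1(5)] and fp2 = face_props[OF 2(5)] and fp3 = face_props[OF 3(5)]
  have sub: "path_image c \<union> path_image d1 \<union> path_image d2 \<union> path_image d3 \<subseteq> graph"
    unfolding c(2) 1(4) 2(4) 3(4) using 1(9-11) 2(10,11) 3(10,11) by (auto simp: graph_def)
  have subs: "path_image c \<subseteq> unit_sphere" "path_image d1 \<subseteq> unit_sphere" "path_image d2 \<subseteq> unit_sphere" "path_image d3 \<subseteq> unit_sphere"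
    using sub graph_subset by blast+
  show False
  proof (rule arc_not_on_three_faces[OF c(1) 1(1) 2(1) 3(1) subs c(3,4) 1(2,3) 2(2,3) 3(2,3)])
    show "path_image c \<inter> path_image d1 = {p u, p v}" unfolding c(2) 1(4) using 1(10-13) by (rule chord)
    show "path_image c \<inter> path_image d2 = {p u, p v}" unfolding c(2) 2(4) using 2(10-13) by (rule chord)
    show "path_image c \<inter> path_image d3 = {p u, p v}" unfolding c(2) 3(4) using 3(10-13) by (rule chord)
    show "path_image d1 \<inter> path_image d2 = {p u, p v}" 
      unfolding 1(4) 2(4) using 1(10-13) 2(10-13) ne(2) by (rule detour)
    show "path_image d1 \<inter> path_image d3 = {p u, p v}" 
      unfolding 1(4) 3(4) using 1(10-13) 3(10-13) ne(3) by (rule detour)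
    show "connected F1" "openin (top_of_set unit_sphere) F1" "F1 \<noteq> {}" 
      "connected F2" "openin (top_of_set unit_sphere) F2" "F2 \<noteq> {}"
      "connected F3" "openin (top_of_set unit_sphere) F3" "F3 \<noteq> {}" using fp1 fp2 fp3 by auto
    show "closure F1 - F1 = path_image c \<union> path_image d1" "closure F2 - F2 = path_image c \<union> path_image d2"
      "closure F3 - F3 = path_image c \<union> path_image d3" unfolding c(2) by (fact 1(6) 2(6) 3(6))+
    show "F1 \<inter> F2 = {}" using Fne[OF 1(5) 2(5) 1(7) 2(7) 1(8) 2(8) ne(2) 1(12,13)] .
    show "F1 \<inter> F3 = {}" using Fne[OF 1(5) 3(5) 1(7) 3(7) 1(8) 3(8) ne(3) 1(12,13)] .
    show "F2 \<inter> F3 = {}" using Fne[OF 2(5) 3(5) 2(7) 3(7) 2(8) 3(8) ne(4) 2(12,13)] .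
    show "(F1 \<union> F2 \<union> F3) \<inter> (path_image c \<union> path_image d1 \<union> path_image d2 \<union> path_image d3) = {}"
      using sub fp1(4) fp2(4) fp3(4) by blast
  qed
qed

text \<open>The bound on \<open>card V\<close> matters: in a bare triangle both faces have the same
  frontier and would yield a single element of \<open>triangles\<close>.\<close>

lemma card_triangles_edge:
  assumes V: "card V > 3" and e: "e \<in> E"
  shows "card {t \<in> triangles. e \<subseteq> t} = 2"
proof -
  have cl: "t \<subseteq> V \<and> card t = 3" if "t \<in> triangles" for t using that by (simp add: triangles_def clique_def)
  have fin: "finite {t \<in> triangles. e \<subseteq> t}"
  proof (rule finite_subset)
    show "{t \<in> triangles. e \<subseteq> t} \<subseteq> Pow V" using cl by blast
  qed simp
  obtain t t' where t: "t \<in> triangles" "t' \<in> triangles" "t \<noteq> t'" "e \<subseteq> t" "e \<subseteq> t'" 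
    using edge_in_two_triangles[OF V e] by blast
  have "s = t \<or> s = t'" if s: "s \<in> triangles" "e \<subseteq> s" for s
  proof (rule ccontr)
    assume ne: "\<not> (s = t \<or> s = t')"
    have "card e = 2" using card_edge[OF e] .
    then obtain u v where uv: "e = {u, v}" "u \<noteq> v" by (auto simp: card_2_iff)
    have third: "\<exists>w. r = {u, v, w}" if "r \<in> triangles" "e \<subseteq> r" for r
    proof -
      have "card r = 3" "u \<in> r" "v \<in> r" using cl that uv by auto
      then show ?thesis using uv(2) by (auto simp: card_3_iff)
    qed
    obtain w1 w2 w3 where w: "s = {u, v, w1}" "t = {u, v, w2}" "t' = {u, v, w3}"
      using third s t by meson
    show False
      using edge_not_in_three_triangles[of u v w1 w2 w3] s(1) t(1,2,3) w uv(2) ne by blast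
  qed
  then have "{t \<in> triangles. e \<subseteq> t} = {t, t'}" using t by blast
  then show ?thesis using t(3) by simp
qed

text \<open>\<open>P\<close> and \<open>Q\<close> are the vertices on the two sides of the curve.
  The interior of an edge not contained in \<open>t\<close> avoids the curve and stays on one side,
  so no edge joins \<open>P\<close> to \<open>Q\<close>; a side without vertices would be a face
  bounded by \<open>t\<close>.\<close>

lemma separating_clique:
  assumes t: "clique t" "t \<notin> triangles"
  shows "\<exists>P Q. P \<union> Q = V - t \<and> P \<inter> Q = {} \<and> P \<noteq> {} \<and> Q \<noteq> {} \<and> (\<forall>x\<in>P. \<forall>y\<in>Q. {x, y} \<notin> E)"
proof -
  obtain D1 D2 where D: "D1 \<union> D2 = unit_sphere - curve t" "D1 \<inter> D2 = {}"
    "openin (top_of_set unit_sphere) D1" "openin (top_of_set unit_sphere) D2"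
    "connected D1" "connected D2" "D1 \<noteq> {}" "D2 \<noteq> {}"
    "closure D1 = D1 \<union> curve t" "closure D2 = D2 \<union> curve t" using sides[OF t(1)] .
  have tV: "t \<subseteq> V" using t(1) by (simp add: clique_def)
  have off: "p v \<in> D1 \<union> D2 \<longleftrightarrow> v \<notin> t" if v: "v \<in> V" for v
  proof -
    have "p v \<in> curve t \<longleftrightarrow> v \<in> t" 
      using curve_vertices[OF t(1)] v inj_on_image_mem_iff[OF inj_p v tV] by blast
    then show ?thesis using D(1) p_in[OF v] by blast
  qed
  have edge_side: "path_image (\<gamma> e) - p ` e \<subseteq> D1 \<or> path_image (\<gamma> e) - p ` e \<subseteq> D2"
    if e: "e \<in> E" "\<not> e \<subseteq> t" for e
  proof -
    have "path_image (\<gamma> e) - p ` e \<subseteq> D1 \<union> D2"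
      using curve_interior_edge[OF e(1)] e(2) \<gamma>_in[OF e(1)] D(1) by blast
    then show ?thesis using connected_subset_either[OF open_edge(1)[OF e(1)] D(3,4,2)] by blast
  qed
  \<comment> \<open>An arc has no isolated points, and deleting its two ends does not change its
    limit points.\<close>
  have end_closure: "p x \<in> closure (path_image (\<gamma> e) - p ` e)" if e: "e \<in> E" "x \<in> e" for e x
  proof -
    have "p x \<in> path_image (\<gamma> e)" using \<gamma>_vertices[OF e(1)] e(2) by blast
    moreover have "connected (path_image (\<gamma> e))" 
      using arc_\<gamma>[OF e(1)] by (simp add: arc_imp_path connected_path_image)
    moreover have "path_image (\<gamma> e) \<noteq> {y}" for y
      using arc_distinct_ends[OF arc_\<gamma>[OF e(1)]] pathstart_in_path_image[of "\<gamma> e"] pathfinish_in_path_image[of "\<gamma> e"]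
      by auto
    ultimately have "p x islimpt path_image (\<gamma> e)" by (intro connected_imp_perfect) auto
    moreover have "finite (p ` e)" using edge_subset[OF e(1)] finite_subset[OF _ finite_V] by blast
    moreover have "path_image (\<gamma> e) \<subseteq> p ` e \<union> (path_image (\<gamma> e) - p ` e)" by blast
    ultimately have "p x islimpt (path_image (\<gamma> e) - p ` e)"
      using islimpt_Un_finite islimpt_subset by metis
    then show ?thesis by (simp add: closure_def)
  qed
  have end_side: "path_image (\<gamma> e) - p ` e \<subseteq> D"
    if e: "e \<in> E" "x \<in> e" "p x \<in> D" "(D, D') \<in> {(D1, D2), (D2, D1)}" for e x D D'
  proof -
    have "x \<notin> t" using off[of x] e edge_subset[OF e(1)] by auto
    then have "\<not> e \<subseteq> t" using e(2) by blast
    moreover have "\<not> path_image (\<gamma> e) - p ` e \<subseteq> D'"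
    proof
      assume "path_image (\<gamma> e) - p ` e \<subseteq> D'"
      then have "p x \<in> closure D'" using end_closure[OF e(1,2)] closure_mono by blast
      moreover have "D \<inter> closure D' = {}" using D e(4) by auto
      ultimately show False using e(3) by blast
    qed
    ultimately show ?thesis using edge_side[OF e(1)] e(4) by blast
  qed
  \<comment> \<open>An edge entering a side without vertices would have an end off \<open>t\<close>.
    That end lies on the other side and forces the whole open edge to be there.\<close>
  have nonempty: "\<exists>v\<in>V. p v \<in> D" if DD: "(D, D') \<in> {(D1, D2), (D2, D1)}" for D D'
  proof (rule ccontr)
    assume none: "\<not> ?thesis"
    have props: "D \<noteq> {}" "connected D" "openin (top_of_set unit_sphere) D" "closure D = D \<union> curve t" 
      "D \<inter> curve t = {}" "D \<subseteq> unit_sphere" "D \<inter> D' = {}" "D \<union> D' = D1 \<union> D2"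
      using DD D by auto
    have "D \<inter> graph = {}"
    proof (rule ccontr)
      assume "D \<inter> graph \<noteq> {}"
      then obtain z where z: "z \<in> D" "z \<in> graph" by blast
      then obtain e where e: "e \<in> E" "z \<in> path_image (\<gamma> e)" using none by (auto simp: graph_def)
      have "\<not> e \<subseteq> t" using e z(1) props(5) by (auto simp: curve_def)
      then obtain x where x: "x \<in> e" "x \<notin> t" by blast
      have xV: "x \<in> V" using x(1) edge_subset[OF e(1)] by blast
      then have "p x \<in> D'" using off[OF xV] x(2) none props(8) by blast
      then have "path_image (\<gamma> e) - p ` e \<subseteq> D'" using end_side[OF e(1) x(1), of D' D] DD by auto
      moreover have "z \<notin> p ` e" using none z(1) edge_subset[OF e(1)] by blast
      ultimately show False using e(2) z(1) props(7) by blast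
    qed
    then have "D \<subseteq> unit_sphere - graph" using props(6) by blast
    moreover have "closure D \<subseteq> D \<union> graph" using props(4) curve_subset by blast
    ultimately have "D \<in> faces" using faceI[OF props(1-3)] by blast
    moreover have "closure D - D = curve t" using props(4,5) by blast
    ultimately show False using t by (auto simp: triangles_def)
  qed
  let ?P = "{v \<in> V. p v \<in> D1}" and ?Q = "{v \<in> V. p v \<in> D2}"
  have "{x, y} \<notin> E" if xy: "x \<in> ?P" "y \<in> ?Q" for x y
  proof
    assume e: "{x, y} \<in> E"
    have "path_image (\<gamma> {x, y}) - p ` {x, y} \<subseteq> D1" using end_side[OF e, of x D1 D2] xy by auto
    moreover have "path_image (\<gamma> {x, y}) - p ` {x, y} \<subseteq> D2" using end_side[OF e, of y D2 D1] xy by auto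
    ultimately show False using open_edge(2)[OF e] D(2) by blast
  qed
  moreover have "?P \<union> ?Q = V - t" using off by blast
  moreover have "?P \<inter> ?Q = {}" using D(2) by blast
  moreover have "?P \<noteq> {}" "?Q \<noteq> {}" using nonempty[of D1 D2] nonempty[of D2 D1] by auto
  ultimately show ?thesis by blast
qed

end

section \<open>Even triangulations with seven vertices\<close>

text \<open>\<open>T\<close> stands for the set of face triangles of a triangulation of the sphere.\<close>

locale separating_triangulation =
  fixes V :: "'a set" and E T :: "'a set set"
  assumes finite_vertices: "finite V"
    and edges: "e \<in> E \<Longrightarrow> e \<subseteq> V \<and> card e = 2"
    and triangles_clique: "t \<in> T \<Longrightarrow> t \<subseteq> V \<and> card t = 3 \<and> (\<forall>x\<in>t. \<forall>y\<in>t. x \<noteq> y \<longrightarrow> {x, y} \<in> E)"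
    and edge_triangles: "e \<in> E \<Longrightarrow> card {t \<in> T. e \<subseteq> t} = 2"
    and vertex_edge: "v \<in> V \<Longrightarrow> \<exists>e\<in>E. v \<in> e"
    and separating: "{a, b} \<in> E \<Longrightarrow> {b, c} \<in> E \<Longrightarrow> {a, c} \<in> E \<Longrightarrow> a \<noteq> b \<Longrightarrow> b \<noteq> c \<Longrightarrow> a \<noteq> c \<Longrightarrow> {a, b, c} \<notin> T \<Longrightarrow>
      \<exists>P Q. P \<union> Q = V - {a, b, c} \<and> P \<inter> Q = {} \<and> P \<noteq> {} \<and> Q \<noteq> {} \<and> (\<forall>x\<in>P. \<forall>y\<in>Q. {x, y} \<notin> E)"
begin

definition adj where "adj a b \<longleftrightarrow> {a, b} \<in> E"
definition face where "face a b c \<longleftrightarrow> {a, b, c} \<in> T"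
definition nbs where "nbs v = {x. adj v x}"

lemma finite_E [simp]: "finite E" and finite_T [simp]: "finite T"
proof -
  have "e \<in> Pow V" if "e \<in> E" for e using edges[OF that] by simp
  moreover have "t \<in> Pow V" if "t \<in> T" for t using triangles_clique[OF that] by simp
  ultimately have "E \<subseteq> Pow V" "T \<subseteq> Pow V" by auto
  moreover have "finite (Pow V)" using finite_vertices by simp
  ultimately show "finite E" "finite T" by (simp_all add: finite_subset)
qed

lemma adj_sym: "adj a b \<Longrightarrow> adj b a"
  by (simp add: adj_def insert_commute)

lemma adj_props: assumes "adj a b" shows "a \<noteq> b" "a \<in> V" "b \<in> V"
  using assms edges[of "{a, b}"] by (auto simp: adj_def)

lemma face_perm: "face a b c \<Longrightarrow> face b a c" "face a b c \<Longrightarrow> face a c b"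
  by (simp_all add: face_def insert_commute)

lemma face_props: 
  assumes "face a b c" 
  shows "a \<noteq> b" "b \<noteq> c" "a \<noteq> c" "adj a b" "adj b c" "adj a c"
proof -
  have t: "card {a, b, c} = 3" "\<forall>x\<in>{a, b, c}. \<forall>y\<in>{a, b, c}. x \<noteq> y \<longrightarrow> {x, y} \<in> E" 
    using triangles_clique[of "{a, b, c}"] assms by (auto simp: face_def)
  then show "a \<noteq> b" "b \<noteq> c" "a \<noteq> c" by (auto simp: card_insert_if split: if_splits)
  then show "adj a b" "adj b c" "adj a c" using t(2) by (auto simp: adj_def)
qed

lemma nbs_subset: "nbs v \<subseteq> V - {v}"
  using adj_props by (auto simp: nbs_def)

lemma finite_nbs [simp]: "finite (nbs v)"
  by (rule finite_subset[OF nbs_subset]) (simp add: finite_vertices)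

lemma card_nbs: "card {e \<in> E. v \<in> e} = card (nbs v)"
proof -
  have "bij_betw (\<lambda>x. {v, x}) (nbs v) {e \<in> E. v \<in> e}"
  proof (intro bij_betw_imageI inj_onI equalityI subsetI)
    fix e assume "e \<in> {e \<in> E. v \<in> e}"
    then have e: "e \<in> E" "v \<in> e" "card e = 2" using edges by auto
    then obtain x y where "e = {x, y}" by (auto simp: card_2_iff)
    then obtain z where "e = {v, z}" using e(2) by auto
    then show "e \<in> (\<lambda>x. {v, x}) ` nbs v" using e(1) by (auto simp: nbs_def adj_def)
  qed (auto simp: nbs_def adj_def doubleton_eq_iff)
  then show ?thesis using bij_betw_same_card by metis
qed

text \<open>\<open>y\<close> and \<open>z\<close> are the apexes of the two triangles on the edge,
  that is, the neighbours of \<open>b\<close> in the link of \<open>a\<close>.\<close>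

lemma link:
  assumes "adj a b"
  shows "\<exists>y z. y \<noteq> z \<and> face a b y \<and> face a b z \<and> (\<forall>w. face a b w \<longrightarrow> w = y \<or> w = z)"
proof -
  have "card {t \<in> T. {a, b} \<subseteq> t} = 2" using assms edge_triangles[of "{a, b}"] unfolding adj_def by blast
  then obtain s t where st: "{t \<in> T. {a, b} \<subseteq> t} = {s, t}" "s \<noteq> t" by (auto simp: card_2_iff)
  have third: "\<exists>y. r = {a, b, y}" if "r \<in> {t \<in> T. {a, b} \<subseteq> t}" for r
  proof -
    have "card r = 3" "a \<in> r" "b \<in> r" using that triangles_clique by auto
    then show ?thesis using adj_props(1)[OF assms] by (auto simp: card_3_iff)
  qed
  have mem: "s \<in> {t \<in> T. {a, b} \<subseteq> t}" "t \<in> {t \<in> T. {a, b} \<subseteq> t}" unfolding st(1) by auto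
  obtain y z where yz: "s = {a, b, y}" "t = {a, b, z}" using third[OF mem(1)] third[OF mem(2)] by auto
  have "face a b y" "face a b z" using mem yz by (auto simp: face_def)
  moreover have "w = y \<or> w = z" if w: "face a b w" for w
  proof -
    have "{a, b, w} \<in> {s, t}" unfolding st(1)[symmetric] using w by (auto simp: face_def)
    then show ?thesis using yz face_props(1,2,3)[OF w] by (auto simp: insert_eq_iff)
  qed
  moreover have "y \<noteq> z" using st(2) yz by auto
  ultimately show ?thesis by blast
qed

lemma card_nbs_ge3:
  assumes "v \<in> V" shows "card (nbs v) \<ge> 3"
proof -
  obtain e where e: "e \<in> E" "v \<in> e" using vertex_edge assms by auto
  then have "{e \<in> E. v \<in> e} \<noteq> {}" by auto
  moreover have "finite {e \<in> E. v \<in> e}" by simp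
  ultimately have "nbs v \<noteq> {}" using card_nbs[of v] by (metis card.empty card_0_eq)
  then obtain x where x: "adj v x" by (auto simp: nbs_def)
  obtain y z where yz: "y \<noteq> z" "face v x y" "face v x z" using link[OF x] by blast
  have "{x, y, z} \<subseteq> nbs v" using x face_props[OF yz(2)] face_props[OF yz(3)] by (auto simp: nbs_def)
  moreover have "card {x, y, z} = 3" using yz(1) face_props[OF yz(2)] face_props[OF yz(3)] by simp
  ultimately show ?thesis using card_mono[OF finite_nbs] by metis
qed

text \<open>Both sides equal \<open>2 * card E\<close>: each triangle has three edges, each edge has
  two triangles and two ends.\<close>

lemma card_triangles: "3 * card T = (\<Sum>v\<in>V. card (nbs v))"
proof -
  have "(\<Sum>t\<in>T. card {e \<in> E. e \<subseteq> t}) = (\<Sum>e\<in>E. 2)"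
    using edge_triangles by (intro sum_multicount_gen) auto
  moreover have "card {e \<in> E. e \<subseteq> t} = 3" if t: "t \<in> T" for t
  proof -
    obtain a b c where abc: "t = {a, b, c}" "a \<noteq> b" "b \<noteq> c" "a \<noteq> c"
      using triangles_clique[OF t] by (auto simp: card_3_iff)
    have "face a b c" using t abc(1) by (simp add: face_def)
    then have "{a, b} \<in> E" "{b, c} \<in> E" "{a, c} \<in> E" using face_props by (auto simp: adj_def)
    moreover have "e \<in> {{a, b}, {b, c}, {a, c}}" if e: "e \<in> E" "e \<subseteq> t" for e
    proof -
      have "card e = 2" using edges[OF e(1)] by simp
      then obtain x y where "e = {x, y}" "x \<noteq> y" by (auto simp: card_2_iff)
      then show ?thesis using e(2) abc by auto
    qed
    ultimately have "{e \<in> E. e \<subseteq> t} = {{a, b}, {b, c}, {a, c}}" using abc(1) by auto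
    then show ?thesis using abc by (auto simp: doubleton_eq_iff)
  qed
  moreover have "(\<Sum>v\<in>V. card {e \<in> E. v \<in> e}) = (\<Sum>e\<in>E. 2)"
  proof (rule sum_multicount_gen[OF finite_vertices finite_E], rule ballI)
    fix e assume "e \<in> E"
    moreover from this have "{v \<in> V. v \<in> e} = e" using edges by auto
    ultimately show "card {v \<in> V. v \<in> e} = 2" using edges by simp
  qed
  ultimately show ?thesis by (simp add: card_nbs)
qed

text \<open>The link of \<open>x\<close> is the 4-cycle \<open>v, y, t, z\<close>: the link
  neighbours of \<open>v\<close> are already \<open>y\<close> and \<open>z\<close>, so
  \<open>t\<close> is not next to \<open>v\<close>, and only \<open>y\<close> and \<open>z\<close>
  remain for it.\<close>

lemma quartic_vertex:
  assumes x: "card (nbs x) = 4" and f: "face v x y" "face v x z" "y \<noteq> z"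
  obtains t where "nbs x = {v, y, z, t}" "t \<notin> {v, y, z}" "face x t y" "face x t z"
proof -
  have vx: "adj v x" using face_props[OF f(1)] by simp
  have dist: "v \<noteq> y" "v \<noteq> z" using face_props f(1,2) by auto
  have sub: "{v, y, z} \<subseteq> nbs x"
    using face_props[OF f(1)] face_props[OF f(2)] adj_sym by (auto simp: nbs_def)
  have "card (nbs x - {v, y, z}) = 1" using sub x dist f(3) by (subst card_Diff_subset) auto
  then obtain t where t: "nbs x - {v, y, z} = {t}" by (auto simp: card_1_singleton_iff)
  then have nx: "nbs x = {v, y, z, t}" "t \<notin> {v, y, z}" using sub by auto
  then have xt: "adj x t" by (auto simp: nbs_def)
  obtain r s where rs: "r \<noteq> s" "face x t r" "face x t s" using link[OF xt] by blast
  have yz: "w = y \<or> w = z" if "face v x w" for w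
    using link[OF vx] f that by metis
  have "w = y \<or> w = z" if w: "face x t w" for w
  proof -
    have "w \<in> nbs x" "w \<noteq> t" using face_props[OF w] by (auto simp: nbs_def)
    moreover have "w \<noteq> v"
    proof
      assume "w = v"
      then have "face v x t" using w face_perm by blast
      then show False using yz nx(2) by auto
    qed
    ultimately show ?thesis using nx by auto
  qed
  then have "face x t y" "face x t z" using rs by metis+
  then show thesis using that nx by blast
qed

text \<open>With \<open>y\<close>, \<open>z\<close> the neighbours of \<open>x\<close> in the link of \<open>v\<close> and \<open>t\<close> the fourth neighbour of \<open>x\<close>, the
  degree condition makes \<open>v, x, y, z, t\<close> pairwise adjacent, which saturates \<open>x, y, z, t\<close> and starves the
  two remaining vertices.\<close>

lemma no_unique_degree_6:
  assumes V: "card V = 7" and v: "v \<in> V" "card (nbs v) = 6" 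
    and four: "\<And>x. x \<in> V \<Longrightarrow> x \<noteq> v \<Longrightarrow> card (nbs x) = 4"
  shows False
proof -
  have nv: "nbs v = V - {v}"
    using nbs_subset[of v] V v finite_vertices by (intro card_subset_eq) auto
  have "nbs v \<noteq> {}" using v(2) by (metis card.empty zero_neq_numeral)
  then obtain x where vx: "adj v x" by (auto simp: nbs_def)
  have four': "card (nbs w) = 4" if "adj v w" for w
    using that adj_props[OF that] four by auto
  obtain y z where yz: "y \<noteq> z" "face v x y" "face v x z" "\<forall>w. face v x w \<longrightarrow> w = y \<or> w = z" 
    using link[OF vx] by blast
  have ne: "x \<noteq> y" "x \<noteq> z" "v \<noteq> y" "v \<noteq> z" "v \<noteq> x" using face_props[OF yz(2)] face_props[OF yz(3)] by auto
  obtain t where t: "nbs x = {v, y, z, t}" "t \<notin> {v, y, z}" "face x t y" "face x t z"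
    using quartic_vertex[OF four'[OF vx] yz(2,3,1)] .
  have vy: "adj v y" and vz: "adj v z" using face_props yz by auto
  have xt: "adj x t" using face_props[OF t(3)] by simp
  have "t \<in> V - {v}" using adj_props[OF xt] t(2) by auto
  then have vt: "adj v t" using nv by (auto simp: nbs_def)
  have nt: "nbs t = {v, x, y, z}"
  proof (rule card_subset_eq[symmetric])
    show "{v, x, y, z} \<subseteq> nbs t"
      using vt xt face_props[OF t(3)] face_props[OF t(4)] adj_sym by (auto simp: nbs_def)
    show "card {v, x, y, z} = card (nbs t)" using four'[OF vt] ne yz(1) by simp
  qed simp
  \<comment> \<open>A face \<open>v t x\<close> would make \<open>t\<close> a third apex on the edge
    from \<open>v\<close> to \<open>x\<close>.\<close>
  have link_vt: "w = y \<or> w = z" if w: "face v t w" for w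
  proof -
    have "w \<in> nbs t" "w \<noteq> v" using face_props[OF w] by (auto simp: nbs_def)
    moreover have "w \<noteq> x" using w yz(4) t(2) face_perm by blast
    ultimately show ?thesis using nt by auto
  qed
  obtain r s where "r \<noteq> s" "face v t r" "face v t s" using link[OF vt] by blast
  then have vty: "face v t y" "face v t z" using link_vt by metis+
  have f: "face v y x" "face v y t" using yz(2) vty(1) face_perm by blast+
  have "x \<noteq> t" using adj_props[OF xt] by simp
  \<comment> \<open>The fourth neighbour of \<open>y\<close> is also adjacent to \<open>x\<close>,
    and among the neighbours of \<open>x\<close> only \<open>z\<close> is left. This gives the last
    missing adjacency, between \<open>y\<close> and \<open>z\<close>.\<close>
  obtain s where s: "nbs y = {v, x, t, s}" "s \<notin> {v, x, t}" "face y s x" "face y s t"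
    using quartic_vertex[OF four'[OF vy] f \<open>x \<noteq> t\<close>] .
  have "s \<in> nbs x" using face_props[OF s(3)] adj_sym by (auto simp: nbs_def)
  moreover have "s \<noteq> y" using face_props[OF s(3)] by simp
  ultimately have "s = z" using t(1) s(2) by auto
  then have ny: "nbs y = {v, x, t, z}" using s(1) by simp
  then have "adj y z" by (auto simp: nbs_def)
  have nz: "nbs z = {v, x, t, y}"
  proof (rule card_subset_eq[symmetric])
    show "{v, x, t, y} \<subseteq> nbs z"
      using vz \<open>adj y z\<close> face_props[OF t(4)] face_props[OF yz(3)] adj_sym by (auto simp: nbs_def)
    show "card {v, x, t, y} = card (nbs z)" using four'[OF vz] ne yz(1) t(2) \<open>x \<noteq> t\<close> by (auto simp: card_insert_if)
  qed simp
  have c5: "card {v, x, y, z, t} = 5" using ne yz(1) t(2) \<open>x \<noteq> t\<close> by auto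
  have "\<not> V \<subseteq> {v, x, y, z, t}" using card_mono[of "{v, x, y, z, t}" V] c5 V by auto
  then obtain w where w: "w \<in> V" "w \<notin> {v, x, y, z, t}" by auto
  have "nbs w \<subseteq> V - {w, x, y, z, t}"
  proof
    fix u assume u: "u \<in> nbs w"
    then have "w \<in> nbs u" using adj_sym by (auto simp: nbs_def)
    then have "u \<notin> {x, y, z, t}" using w(2) t(1) ny nz nt by auto
    then show "u \<in> V - {w, x, y, z, t}" using u nbs_subset[of w] by auto
  qed
  moreover have "card (V - {w, x, y, z, t}) = 2"
    using c5 w V adj_props vx vy vz vt by (subst card_Diff_subset) auto
  ultimately have "card (nbs w) \<le> 2" using finite_vertices by (metis card_mono finite_Diff)
  then show False using four[OF w(1)] w(2) by auto
qed

text \<open>Let \<open>U\<close> be the set of vertices of degree 6, all others having degree 4. Counting incidences gives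
  \<open>card U \<equiv> 1\<close> modulo 3. If \<open>u, v \<in> U\<close>, some triangle \<open>u v w\<close> bounds no face, and the degrees force
  it to separate the other four vertices two by two, so that \<open>U = {u, v, w}\<close>.\<close>

theorem not_even_7:
  assumes V: "card V = 7" and even: "\<And>v. v \<in> V \<Longrightarrow> even (card {e \<in> E. v \<in> e})"
  shows False
proof -
  have deg: "card (nbs v) = 4 \<or> card (nbs v) = 6" if "v \<in> V" for v
  proof -
    have "card (nbs v) \<le> card (V - {v})" using nbs_subset finite_vertices by (intro card_mono) auto
    then have "card (nbs v) \<le> 6" using V that by simp
    moreover have "even (card (nbs v))" using even[OF that] by (simp add: card_nbs)
    moreover have "card (nbs v) \<ge> 3" using card_nbs_ge3[OF that] .
    ultimately show ?thesis by presburger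
  qed
  define U where "U = {v \<in> V. card (nbs v) = 6}"
  have U: "U \<subseteq> V" "finite U" using finite_vertices by (auto simp: U_def)
  have "(\<Sum>v\<in>V. card (nbs v)) = (\<Sum>v\<in>V. 4 + 2 * of_bool (v \<in> U))"
    using deg by (intro sum.cong) (auto simp: U_def)
  also have "\<dots> = 28 + 2 * card U"
    using V U finite_vertices by (simp add: sum.distrib of_bool_def sum.If_cases Int_absorb1 flip: sum_distrib_left)
  finally have "3 * card T = 28 + 2 * card U" using card_triangles by simp
  moreover have "card U \<le> 7" using card_mono[OF finite_vertices U(1)] V by simp
  ultimately have cU: "card U = 1 \<or> card U = 4 \<or> card U = 7" by presburger
  show False
  proof (cases "card U = 1")
    case True
    then obtain v where "U = {v}" by (auto simp: card_1_singleton_iff)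
    then show False using no_unique_degree_6[OF V, of v] deg by (auto simp: U_def)
  next
    case False
    have nU: "nbs u = V - {u}" if "u \<in> U" for u
      using that nbs_subset[of u] V finite_vertices by (intro card_subset_eq) (auto simp: U_def)
    have "card U \<ge> 2" using cU False by auto
    then obtain D where "D \<subseteq> U" "card D = 2" by (meson obtain_subset_with_card_n)
    then obtain u v where uv: "u \<in> U" "v \<in> U" "u \<noteq> v" by (auto simp: card_2_iff)
    have inV: "u \<in> V" "v \<in> V" using uv U by auto
    then have adj_uv: "adj u v" using nU[OF uv(1)] uv by (auto simp: nbs_def)
    obtain y z where yz: "\<forall>w. face u v w \<longrightarrow> w = y \<or> w = z" using link[OF adj_uv] by blast
    \<comment> \<open>Only \<open>y\<close> and \<open>z\<close> can be apexes of faces on the edge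
      \<open>u v\<close>, whereas every other vertex is adjacent to both ends. Any \<open>w\<close>
      outside these four vertices completes a triangle that bounds no face.\<close>
    have "card {u, v, y, z} \<le> 4" by (simp add: card_insert_if)
    then have "\<not> V \<subseteq> {u, v, y, z}" using card_mono[of "{u, v, y, z}" V] V by auto
    then obtain w where w: "w \<in> V" "w \<notin> {u, v, y, z}" by auto
    have uw: "adj u w" "adj v w" using nU uv w by (auto simp: nbs_def)
    have "{u, v, w} \<notin> T" using yz w(2) by (auto simp: face_def)
    moreover have "{u, v} \<in> E" "{v, w} \<in> E" "{u, w} \<in> E" "u \<noteq> v" "v \<noteq> w" "u \<noteq> w"
      using adj_uv uw uv(3) w(2) by (auto simp: adj_def)
    ultimately obtain P Q where PQ: "P \<union> Q = V - {u, v, w}" "P \<inter> Q = {}" "P \<noteq> {}" "Q \<noteq> {}" 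
      "\<forall>x\<in>P. \<forall>y\<in>Q. {x, y} \<notin> E"
      using separating[of u v w] by blast
    have fin: "finite P" "finite Q" using PQ(1) finite_vertices by (metis finite_Diff finite_Un)+
    have "card (P \<union> Q) = 4" unfolding PQ(1) using inV w uv(3) V by (subst card_Diff_subset) auto
    then have c4: "card P + card Q = 4" using card_Un_disjoint[OF fin PQ(2)] by simp
    have sub: "nbs x \<subseteq> {u, v, w} \<union> (A - {x})" if x: "x \<in> A" "A \<union> B = V - {u, v, w}" 
      "\<And>a b. a \<in> A \<Longrightarrow> b \<in> B \<Longrightarrow> \<not> adj a b" for x A B
      using x nbs_subset[of x] by (auto simp: nbs_def)
    have noPQ: "\<not> adj a b" "\<not> adj b a" if "a \<in> P" "b \<in> Q" for a b
      using PQ(5) that adj_sym by (auto simp: adj_def)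
    \<comment> \<open>A neighbour of \<open>x\<close> is one of \<open>u, v, w\<close> or another
      element of its own side \<open>A\<close>, which gives \<open>3 + (card A - 1)\<close>, and one
      less without \<open>w\<close>. Degree at least 4 forces both sides to have size 2; then the
      first bound is attained and \<open>x\<close> is adjacent to \<open>w\<close>.\<close>
    have bound: "card (nbs x) \<le> 2 + card A \<and> (w \<in> nbs x \<or> card (nbs x) \<le> 1 + card A)"
      if x: "x \<in> A" "A \<union> B = V - {u, v, w}" "\<And>a b. a \<in> A \<Longrightarrow> b \<in> B \<Longrightarrow> \<not> adj a b" "finite A" for x A B
    proof -
      have A: "card (A - {x}) = card A - 1" "card A > 0" using x(1,4) by (auto simp: card_gt_0_iff)
      have "card (nbs x) \<le> card ({u, v, w} \<union> (A - {x}))" 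
        using sub[OF x(1,2,3)] x(4) by (intro card_mono) auto
      also have "\<dots> \<le> card {u, v, w} + card (A - {x})" by (rule card_Un_le)
      also have "\<dots> \<le> 2 + card A" using A by (simp add: card_insert_if)
      finally have 1: "card (nbs x) \<le> 2 + card A" .
      have "card (nbs x) \<le> 1 + card A" if "w \<notin> nbs x"
      proof -
        have "card (nbs x) \<le> card ({u, v} \<union> (A - {x}))" 
          using sub[OF x(1,2,3)] x(4) that by (intro card_mono) auto
        also have "\<dots> \<le> card {u, v} + card (A - {x})" by (rule card_Un_le)
        also have "\<dots> \<le> 1 + card A" using A by (simp add: card_insert_if)
        finally show ?thesis .
      qed
      then show ?thesis using 1 by blast
    qed
    have inPQ: "x \<in> V" if "x \<in> P \<union> Q" for x using that PQ(1) by auto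
    have ge4: "card (nbs x) \<ge> 4" if "x \<in> P \<union> Q" for x using deg[OF inPQ[OF that]] by auto
    obtain x0 y0 where "x0 \<in> P" "y0 \<in> Q" using PQ(3,4) by auto
    have QP: "Q \<union> P = V - {u, v, w}" using PQ(1) by auto
    have "card P \<ge> 2" using bound[OF \<open>x0 \<in> P\<close> PQ(1) noPQ(1) fin(1)] ge4[of x0] \<open>x0 \<in> P\<close> by auto
    moreover have "card Q \<ge> 2" using bound[OF \<open>y0 \<in> Q\<close> QP noPQ(2) fin(2)] ge4[of y0] \<open>y0 \<in> Q\<close> by auto
    ultimately have c2: "card P = 2" "card Q = 2" using c4 by auto
    have w_nb: "w \<in> nbs x \<and> card (nbs x) = 4" if "x \<in> P \<union> Q" for x
    proof (cases "x \<in> P")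
      case True
      then show ?thesis using bound[OF True PQ(1) noPQ(1) fin(1)] ge4[OF that] c2 by auto
    next
      case False
      then have "x \<in> Q" using that by auto
      then show ?thesis using bound[OF \<open>x \<in> Q\<close> QP noPQ(2) fin(2)] ge4[OF that] c2 by auto
    qed
    have "nbs w = V - {w}"
    proof (intro equalityI nbs_subset subsetI)
      fix x assume x: "x \<in> V - {w}"
      show "x \<in> nbs w"
      proof (cases "x \<in> P \<union> Q")
        case True
        then show ?thesis using w_nb adj_sym by (auto simp: nbs_def)
      next
        case False
        then have "x = u \<or> x = v" using x PQ(1) by auto
        then show ?thesis using uw adj_sym by (auto simp: nbs_def)
      qed
    qed
    then have "w \<in> U" using w V by (simp add: U_def)
    have "U = {u, v, w}"
    proof (intro equalityI subsetI)
      fix x assume x: "x \<in> U"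
      then have "x \<notin> P \<union> Q" using w_nb by (auto simp: U_def)
      then show "x \<in> {u, v, w}" using x U PQ(1) by auto
    qed (use uv \<open>w \<in> U\<close> in auto)
    then have "card U = 3" using uv(3) w(2) by auto
    then show False using cU by simp
  qed
qed

end

theorem no_even_sphere_triangulation_7:
  assumes "simple_sphere_triangulation V E p \<gamma>" "all_degrees_even V E" "card V = 7"
  shows False
proof -
  interpret sphere_triangulation V E p \<gamma> by unfold_locales (rule assms(1))
  interpret comb: separating_triangulation V E triangles
  proof
    show "e \<subseteq> V \<and> card e = 2" if "e \<in> E" for e using edge_subset card_edge that by blast
    show "t \<subseteq> V \<and> card t = 3 \<and> (\<forall>x\<in>t. \<forall>y\<in>t. x \<noteq> y \<longrightarrow> {x, y} \<in> E)" if "t \<in> triangles" for t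
      using that by (simp add: triangles_def clique_def)
    show "card {t \<in> triangles. e \<subseteq> t} = 2" if "e \<in> E" for e
      using card_triangles_edge[OF _ that] assms(3) by simp
    show "\<exists>e\<in>E. v \<in> e" if v: "v \<in> V" for v
    proof -
      obtain t where t: "t \<in> triangles" "v \<in> t" using vertex_in_triangle[OF v] by blast
      then have "clique t" by (simp add: triangles_def)
      then obtain a b c where abc: "t = {a, b, c}" "{a, b} \<in> E" "{b, c} \<in> E" by (rule cliqueE)
      then have "v \<in> {a, b} \<or> v \<in> {b, c}" using t(2) by auto
      then show ?thesis using abc(2,3) by blast
    qed
    show "\<exists>P Q. P \<union> Q = V - {a, b, c} \<and> P \<inter> Q = {} \<and> P \<noteq> {} \<and> Q \<noteq> {} \<and> (\<forall>x\<in>P. \<forall>y\<in>Q. {x, y} \<notin> E)"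
      if "{a, b} \<in> E" "{b, c} \<in> E" "{a, c} \<in> E" "a \<noteq> b" "b \<noteq> c" "a \<noteq> c" "{a, b, c} \<notin> triangles" for a b c
      using separating_clique[OF cliqueI[OF that(1-6)] that(7)] .
  qed (rule finite_V)
  show False
    using comb.not_even_7[OF assms(3)] assms(2) by (simp add: all_degrees_even_def)
qed

theorem theorem6p1:
  "(\<not> (\<exists>(V :: 'a set) E. polyhedral_graph V E \<and> bipartite V E \<and>
          card V = 10 \<and> card E = 15)) \<and>
   (\<not> (\<exists>(V :: 'a set) E A B. polyhedral_graph V E \<and> bipartition V E A B \<and>
          card A = 5 \<and> card B = 5 \<and> card E = 3 * 5)) \<and>
   (\<not> (\<exists>(V :: 'a set) E p \<gamma>. simple_sphere_triangulation V E p \<gamma> \<and>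
          all_degrees_even V E \<and> card V = 7))"
proof (intro conjI notI; elim exE conjE)
  fix V :: "'a set" and E
  assume "polyhedral_graph V E" "bipartite V E" "card V = 10" "card E = 15"
  then show False by (rule polyhedral_not_bipartite_10_15)
next
  fix V :: "'a set" and E A B
  assume G: "polyhedral_graph V E" "bipartition V E A B" "card A = 5" "card B = 5" "card E = 3 * 5"
  then have "bipartite V E" "card V = 10"
    using card_Un_disjoint[of A B] by (auto simp: bipartition_def bipartite_def card_ge_0_finite)
  then show False using polyhedral_not_bipartite_10_15 G by fastforce
next
  fix V :: "'a set" and E p \<gamma>
  assume "simple_sphere_triangulation V E p \<gamma>" "all_degrees_even V E" "card V = 7"
  then show False by (rule no_even_sphere_triangulation_7)
qed

end
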